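(* For every positive integer $k$ and every positive integer $n$, we have $$ex^{*}(n, P_{k+1}) < \left(\frac{9k}{7}+2\right)n.$$
   Context: For an integer $k$, $P_k$ denotes a path of length $k$, i.e. with $k$ edges. An edge-colored graph is rainbow if all its edges have different colors. For a graph $F$, the rainbow Turán number $ex^{*}(n,F)$ is the maximum number of edges in a graph on $n$ vertices that has a proper edge-coloring containing no rainbow copy of $F$. *)

theory Defs
  imports Complex_Main
begin

text \<open>
  A graph is a pair of a vertex set and a set of edges, an edge being a two-element set of vertices.
  All graphs are finite and simple.
\<close>

type_synonym 'a graph = "'a set \<times> 'a set set"

abbreviation verts :: "'a graph \<Rightarrow> 'a set" where
  "verts G \<equiv> fst G"

abbreviation edges :: "'a graph \<Rightarrow> 'a set set" where
  "edges G \<equiv> snd G"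

definition simple_graph :: "'a graph \<Rightarrow> bool" where
  "simple_graph G \<longleftrightarrow> finite (verts G) \<and> (\<forall>e\<in>edges G. e \<subseteq> verts G \<and> card e = 2)"

definition proper_edge_coloring :: "'a graph \<Rightarrow> ('a set \<Rightarrow> 'c) \<Rightarrow> bool" where
  "proper_edge_coloring G c \<longleftrightarrow>
     (\<forall>e\<in>edges G. \<forall>f\<in>edges G. e \<noteq> f \<and> e \<inter> f \<noteq> {} \<longrightarrow> c e \<noteq> c f)"

definition rainbow :: "('a set \<Rightarrow> 'c) \<Rightarrow> 'a set set \<Rightarrow> bool" where
  "rainbow c D \<longleftrightarrow> inj_on c D"

text \<open>
  A copy of \<open>F\<close> in \<open>G\<close> is a subgraph of \<open>G\<close>, not necessarily induced, isomorphic to \<open>F\<close>; it is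
  given as the image of an injective edge-preserving map.
\<close>

definition has_rainbow_copy :: "'b graph \<Rightarrow> 'a graph \<Rightarrow> ('a set \<Rightarrow> 'c) \<Rightarrow> bool" where
  "has_rainbow_copy F G c \<longleftrightarrow>
     (\<exists>\<phi>. inj_on \<phi> (verts F) \<and> \<phi> ` verts F \<subseteq> verts G \<and>
          (\<lambda>e. \<phi> ` e) ` edges F \<subseteq> edges G \<and>
          rainbow c ((\<lambda>e. \<phi> ` e) ` edges F))"

text \<open>
  The edge counts of the graphs on \<open>n\<close> vertices that have a proper edge-colouring without a rainbow
  copy of \<open>F\<close>. Up to isomorphism the vertex set is \<open>{..<n}\<close>, and since the graphs are finite,
  natural numbers suffice as colours.
\<close>

definition rainbow_free_sizes :: "nat \<Rightarrow> 'b graph \<Rightarrow> nat set" where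
  "rainbow_free_sizes n F =
     {card (edges G) | G :: nat graph.
        simple_graph G \<and> verts G = {..<n} \<and>
        (\<exists>c :: nat set \<Rightarrow> nat. proper_edge_coloring G c \<and> \<not> has_rainbow_copy F G c)}"

definition rainbow_turan :: "nat \<Rightarrow> 'b graph \<Rightarrow> nat" where
  "rainbow_turan n F = Max (rainbow_free_sizes n F)"

definition path_graph :: "nat \<Rightarrow> nat graph" where
  "path_graph k = ({0..k}, {{i, Suc i} | i. i < k})"

text \<open>
  The maximum is taken over a finite set, which is nonempty as soon as \<open>F\<close> has an edge.
\<close>

lemma finite_rainbow_free_sizes: "finite (rainbow_free_sizes n F)"
proof (rule finite_subset)
  show "rainbow_free_sizes n F \<subseteq> card ` Pow (Pow {..<n})"
    unfolding rainbow_free_sizes_def simple_graph_def by fastforce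
qed simp

lemma rainbow_free_sizes_nonempty:
  assumes "edges F \<noteq> {}"
  shows "rainbow_free_sizes n F \<noteq> {}"
proof -
  let ?G = "({..<n}, {}) :: nat graph"
  have "simple_graph ?G" "proper_edge_coloring ?G (\<lambda>_. 0 :: nat)"
    by (simp_all add: simple_graph_def proper_edge_coloring_def)
  moreover have "\<not> has_rainbow_copy F ?G (\<lambda>_. 0 :: nat)"
    using assms by (auto simp: has_rainbow_copy_def)
  ultimately have "card (edges ?G) \<in> rainbow_free_sizes n F"
    unfolding rainbow_free_sizes_def by force
  then show ?thesis by blast
qed

end

theory Submission
  imports Defs
begin

text \<open>
  Put \<open>c = 9 * k / 7 + 2\<close>. In a smallest nonempty set of vertices spanning at least \<open>c\<close> times as many edges
  as it has vertices, every set \<open>S\<close> of vertices touches at least \<open>c * card S\<close> edges. Let \<open>L \<le> k\<close> be the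
  length of a longest rainbow path there and \<open>V\<close> the vertex set of such a path. An end \<open>v\<close> of a longest
  rainbow path on \<open>V\<close> can leave \<open>V\<close> only through colours used by all longest rainbow paths on \<open>V\<close> that
  end in \<open>v\<close>. Rotating paths at edges of unused colours, of which each end has at least
  \<open>2 * L / 7 + 2\<close>, yields many such ends, each missing many path colours to the outside. If the average
  number of missed colours over a set \<open>S\<close> of ends, plus half the size of \<open>S\<close>, is too large, then \<open>S\<close>
  touches too few edges.

  There are three cases. If a rainbow cycle runs through \<open>V\<close>, take \<open>S = V\<close>. If a rainbow cycle misses
  exactly one vertex \<open>u\<close> of \<open>V\<close> and \<open>u\<close> sends an edge of a new colour to it, take for \<open>S\<close> the successors
  on the cycle of the neighbours of \<open>u\<close> in new colours. Otherwise the rotations at the two ends of a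
  path remove almost disjoint sets of colours and produce almost disjoint sets of ends, and counting
  pairs of a removed colour and an end missing it gives \<open>S\<close>.
\<close>

section \<open>Rainbow paths and rotations\<close>

locale colored_graph =
  fixes U :: "'a set" and E :: "'a set set" and col :: "'a set \<Rightarrow> 'c"
  assumes finite_verts: "finite U"
    and edge_verts: "e \<in> E \<Longrightarrow> e \<subseteq> U \<and> card e = 2"
    and proper: "e \<in> E \<Longrightarrow> f \<in> E \<Longrightarrow> e \<noteq> f \<Longrightarrow> e \<inter> f \<noteq> {} \<Longrightarrow> col e \<noteq> col f"
begin

abbreviation adj :: "'a \<Rightarrow> 'a \<Rightarrow> bool" where "adj x y \<equiv> {x, y} \<in> E"
abbreviation ecol :: "'a \<Rightarrow> 'a \<Rightarrow> 'c" where "ecol x y \<equiv> col {x, y}"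

lemma adj_commute: "adj x y \<longleftrightarrow> adj y x" by (simp add: insert_commute)
lemma ecol_commute: "ecol x y = ecol y x" by (simp add: insert_commute)

lemma adj_neq: "adj x y \<Longrightarrow> x \<noteq> y"
  using edge_verts[of "{x, y}"] by auto

lemma adj_verts: "adj x y \<Longrightarrow> x \<in> U \<and> y \<in> U"
  using edge_verts[of "{x, y}"] by auto

lemma ecol_inj: "adj x y \<Longrightarrow> adj x z \<Longrightarrow> ecol x y = ecol x z \<Longrightarrow> y = z"
  using proper[of "{x, y}" "{x, z}"] by (auto simp: doubleton_eq_iff)

lemma ecol_inj': "adj y x \<Longrightarrow> adj z x \<Longrightarrow> ecol y x = ecol z x \<Longrightarrow> y = z"
  using ecol_inj[of x y z] by (simp add: adj_commute ecol_commute)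

lemma edge_pair: "e \<in> E \<Longrightarrow> x \<in> e \<Longrightarrow> \<exists>y. e = {x, y} \<and> x \<noteq> y"
  using edge_verts[of e] by (auto simp: card_2_iff)

section \<open>Paths as vertex lists with their lists of edge colours\<close>

fun ecols :: "'a list \<Rightarrow> 'c list" where
  "ecols (x # y # r) = ecol x y # ecols (y # r)"
| "ecols [] = []"
| "ecols [x] = []"

lemma ecols_Cons: "ys \<noteq> [] \<Longrightarrow> ecols (x # ys) = ecol x (hd ys) # ecols ys"
  by (cases ys) auto

lemma ecols_append:
  "xs \<noteq> [] \<Longrightarrow> ys \<noteq> [] \<Longrightarrow> ecols (xs @ ys) = ecols xs @ ecol (last xs) (hd ys) # ecols ys"
  by (induction xs rule: ecols.induct) (auto simp: ecols_Cons)

lemma ecols_rev: "ecols (rev xs) = rev (ecols xs)"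
proof (induction xs)
  case (Cons x xs)
  then show ?case
    by (cases "xs = []") (auto simp: ecols_append ecols_Cons last_rev ecol_commute)
qed simp

lemma length_ecols: "length (ecols xs) = length xs - 1"
  by (induction xs rule: ecols.induct) auto

lemma nth_ecols: "Suc i < length xs \<Longrightarrow> ecols xs ! i = ecol (xs ! i) (xs ! Suc i)"
proof (induction xs arbitrary: i rule: ecols.induct)
  case (1 x y r)
  then show ?case by (cases i) auto
qed auto

definition rpath :: "'a list \<Rightarrow> bool" where
  "rpath xs \<longleftrightarrow> xs \<noteq> [] \<and> set xs \<subseteq> U \<and> distinct xs \<and> successively adj xs \<and> distinct (ecols xs)"

lemma rpath_append:
  assumes "xs \<noteq> []" "ys \<noteq> []"
  shows "rpath (xs @ ys) \<longleftrightarrow> rpath xs \<and> rpath ys \<and> set xs \<inter> set ys = {} \<and> adj (last xs) (hd ys)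
    \<and> ecol (last xs) (hd ys) \<notin> set (ecols xs) \<and> ecol (last xs) (hd ys) \<notin> set (ecols ys)
    \<and> set (ecols xs) \<inter> set (ecols ys) = {}"
  using assms by (auto simp: rpath_def ecols_append successively_append_iff)

lemma rpath_rev [simp]: "rpath (rev xs) \<longleftrightarrow> rpath xs"
proof -
  have "successively adj (rev xs) = successively (\<lambda>x y. adj y x) xs"
    by (rule successively_rev)
  also have "\<dots> = successively adj xs" by (simp add: adj_commute)
  finally show ?thesis by (auto simp: rpath_def ecols_rev)
qed

lemma rpath_singleton [simp]: "rpath [x] \<longleftrightarrow> x \<in> U"
  by (auto simp: rpath_def)

lemma rpath_snoc: "xs \<noteq> [] \<Longrightarrow> rpath (xs @ [y]) \<longleftrightarrow>
   rpath xs \<and> y \<notin> set xs \<and> adj (last xs) y \<and> ecol (last xs) y \<notin> set (ecols xs)"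
  by (auto simp: rpath_append dest: adj_verts)

lemma rpath_Cons: "xs \<noteq> [] \<Longrightarrow> rpath (y # xs) \<longleftrightarrow>
   rpath xs \<and> y \<notin> set xs \<and> adj y (hd xs) \<and> ecol y (hd xs) \<notin> set (ecols xs)"
  using rpath_append[of "[y]" xs] by (auto dest: adj_verts)

text \<open>The closing edge makes a rainbow cycle, which is then opened at the junction of
  \<open>p\<close> and \<open>q\<close>.\<close>

lemma rpath_swap:
  assumes "rpath (p @ q)" "p \<noteq> []" "q \<noteq> []" "adj (last q) (hd p)" "ecol (last q) (hd p) \<notin> set (ecols (p @ q))"
  shows "rpath (q @ p)"
  using assms by (auto simp: rpath_append ecols_append)

section \<open>Rotations at the first vertex\<close>

definition rot :: "nat \<Rightarrow> 'a list \<Rightarrow> 'a list" where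
  "rot a xs = rev (take a xs) @ drop a xs"

lemma length_rot [simp]: "length (rot a xs) = length xs" by (simp add: rot_def)
lemma set_rot [simp]: "set (rot a xs) = set xs"
  by (metis append_take_drop_id rot_def set_append set_rev)

lemma nth_rot:
  assumes "a \<le> length xs" "i < length xs"
  shows "rot a xs ! i = (if i < a then xs ! (a - 1 - i) else xs ! i)"
  using assms by (auto simp: rot_def nth_append rev_nth)

lemma last_rot: "a < length xs \<Longrightarrow> last (rot a xs) = last xs"
  by (auto simp: rot_def)

lemma hd_rot: "0 < a \<Longrightarrow> a \<le> length xs \<Longrightarrow> hd (rot a xs) = xs ! (a - 1)"
  using nth_rot[of a xs 0] by (cases xs) (auto simp: hd_conv_nth rot_def)

text \<open>The chord from \<open>hd xs\<close> to \<open>xs ! a\<close> replaces the path edge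
  between positions \<open>a - 1\<close> and \<open>a\<close>, so one colour is traded for a new one
  and \<open>xs ! (a - 1)\<close> becomes the first vertex.\<close>

lemma rot_path:
  assumes "rpath xs" "0 < a" "a < length xs" "adj (hd xs) (xs ! a)" "ecol (hd xs) (xs ! a) \<notin> set (ecols xs)"
  shows "rpath (rot a xs)"
    and "set (ecols (rot a xs)) = insert (ecol (hd xs) (xs ! a)) (set (ecols xs) - {ecol (xs ! (a - 1)) (xs ! a)})"
proof -
  define as bs where "as = take a xs" and "bs = drop a xs"
  have xs: "xs = as @ bs" and ne: "as \<noteq> []" "bs \<noteq> []" using assms by (auto simp: as_def bs_def)
  have hd: "hd as = hd xs" "hd bs = xs ! a" using assms by (auto simp: as_def bs_def hd_drop_conv_nth)
  have "last as = as ! (a - 1)" using assms ne by (simp add: as_def last_conv_nth min_def)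
  then have hd: "hd as = hd xs" "hd bs = xs ! a" "last as = xs ! (a - 1)" using hd assms by (auto simp: as_def)
  have p: "rpath (as @ bs)" using assms xs by simp
  note pp = p[unfolded rpath_append[OF ne]]
  have ec: "set (ecols xs) = insert (ecol (last as) (hd bs)) (set (ecols as) \<union> set (ecols bs))"
    using ne by (simp add: xs ecols_append)
  have new: "ecol (hd xs) (xs ! a) \<notin> set (ecols as)" "ecol (hd xs) (xs ! a) \<notin> set (ecols bs)"
    using assms(5) ec by auto
  show "rpath (rot a xs)"
    unfolding rot_def as_def[symmetric] bs_def[symmetric]
    using ne pp new assms(4) hd by (subst rpath_append) (auto simp: last_rev ecols_rev)
  show "set (ecols (rot a xs)) = insert (ecol (hd xs) (xs ! a)) (set (ecols xs) - {ecol (xs ! (a - 1)) (xs ! a)})"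
    unfolding rot_def as_def[symmetric] bs_def[symmetric]
    using ne pp hd ec by (auto simp: ecols_append last_rev ecols_rev)
qed

lemma nth_ecol_inj:
  assumes "rpath xs" "Suc i < length xs" "Suc j < length xs"
    "ecol (xs ! i) (xs ! Suc i) = ecol (xs ! j) (xs ! Suc j)"
  shows "i = j"
proof -
  have "ecols xs ! i = ecols xs ! j" using assms by (simp add: nth_ecols)
  then show ?thesis using assms by (simp add: rpath_def nth_eq_iff_index_eq length_ecols)
qed

lemma ecol_nth_mem: "Suc i < length xs \<Longrightarrow> ecol (xs ! i) (xs ! Suc i) \<in> set (ecols xs)"
  by (metis length_ecols less_diff_conv nth_ecols nth_mem plus_1_eq_Suc add.commute)

lemma card_ecols: "rpath xs \<Longrightarrow> card (set (ecols xs)) = length xs - 1"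
  by (simp add: rpath_def distinct_card length_ecols)

end

section \<open>Ends of longest rainbow paths\<close>

text \<open>For single vertices \<open>touching\<close> is a minimum degree condition; for larger
  \<open>S\<close> it is the inequality to be contradicted. That length \<open>L\<close> is attained
  is not assumed here: \<open>lpath\<close> expresses it, and \<open>no_lpath\<close> refutes
  it.\<close>

locale longest_rainbow = colored_graph U E col
  for U :: "'a set" and E :: "'a set set" and col :: "'a set \<Rightarrow> 'c" +
  fixes L :: nat
  assumes longest: "rpath xs \<Longrightarrow> length xs \<le> Suc L"
    and touching: "S \<subseteq> U \<Longrightarrow> S \<noteq> {} \<Longrightarrow> (9 * real L / 7 + 2) * card S \<le> card {e \<in> E. e \<inter> S \<noteq> {}}"
begin

text \<open>The lower bound on degrees minus the \<open>L\<close> colours of a longest path: each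
  vertex has at least this many edges in colours off the path.\<close>

definition excess :: real where "excess = 2 * real L / 7 + 2"

definition lpath :: "'a list \<Rightarrow> bool" where
  "lpath xs \<longleftrightarrow> rpath xs \<and> length xs = Suc L"

definition outdeg :: "'a set \<Rightarrow> 'a \<Rightarrow> nat" where
  "outdeg V v = card {w. adj v w \<and> w \<notin> V}"

lemma finite_nbrs [simp]: "finite {w. adj v w \<and> P w}" "finite {w. adj v w}"
  using finite_verts adj_verts by (auto intro!: finite_subset[of _ U])

lemma degree: 
  assumes "v \<in> U"
  shows "real L + excess \<le> card {w. adj v w}"
proof -
  have "{e \<in> E. e \<inter> {v} \<noteq> {}} = (\<lambda>w. {v, w}) ` {w. adj v w}"
    using edge_pair by blast
  moreover have "inj_on (\<lambda>w. {v, w}) {w. adj v w}"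
    by (auto simp: inj_on_def doubleton_eq_iff)
  ultimately have "card {e \<in> E. e \<inter> {v} \<noteq> {}} = card {w. adj v w}"
    by (simp add: card_image)
  then show ?thesis using touching[of "{v}"] assms by (simp add: excess_def)
qed

lemma lpath_rev [simp]: "lpath (rev xs) \<longleftrightarrow> lpath xs" by (simp add: lpath_def)

lemma lpath_nonempty: "lpath xs \<Longrightarrow> xs \<noteq> []" by (auto simp: lpath_def)

lemma lpath_hd: "lpath xs \<Longrightarrow> hd xs \<in> U"
  by (cases xs) (auto simp: lpath_def rpath_def)

lemma lpath_card: "lpath xs \<Longrightarrow> card (set xs) = Suc L"
  by (auto simp: lpath_def rpath_def distinct_card)

text \<open>Otherwise \<open>w\<close> could be put in front of the path.\<close>

lemma outside_color:
  assumes "lpath xs" "adj (hd xs) w" "w \<notin> set xs"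
  shows "ecol (hd xs) w \<in> set (ecols xs)"
proof (rule ccontr)
  assume "ecol (hd xs) w \<notin> set (ecols xs)"
  then have "rpath (w # xs)"
    using assms lpath_nonempty[OF assms(1)] 
    by (simp add: rpath_Cons lpath_def adj_commute ecol_commute)
  from longest[OF this] show False using assms(1) by (simp add: lpath_def)
qed

lemma outdeg_colors: "outdeg V v = card {ecol v w | w. adj v w \<and> w \<notin> V}"
proof -
  have "inj_on (ecol v) {w. adj v w \<and> w \<notin> V}"
    by (auto simp: inj_on_def intro: ecol_inj)
  from card_image[OF this] show ?thesis
    by (simp add: outdeg_def image_Collect)
qed

text \<open>The edges leaving the vertex set at \<open>hd xs\<close> have distinct colours, and by
  \<open>outside_color\<close> these lie on every longest path with the same vertices and the same
  first vertex. So no colour of \<open>M\<close> occurs among them.\<close>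

lemma outdeg_le:
  assumes xs: "lpath xs" 
    and M: "M \<subseteq> set (ecols xs)" "\<And>c. c \<in> M \<Longrightarrow> \<exists>ys. lpath ys \<and> set ys = set xs \<and> hd ys = hd xs \<and> c \<notin> set (ecols ys)"
  shows "outdeg (set xs) (hd xs) + card M \<le> L"
proof -
  let ?O = "{ecol (hd xs) w | w. adj (hd xs) w \<and> w \<notin> set xs}"
  have "?O \<subseteq> set (ecols xs) - M"
    using outside_color[OF xs] M(2) outside_color by force
  then have "card ?O \<le> card (set (ecols xs) - M)" by (intro card_mono) auto
  also have "\<dots> = L - card M" using M(1) xs 
    by (subst card_Diff_subset) (auto simp: lpath_def card_ecols intro: finite_subset)
  finally show ?thesis using M(1) card_mono[OF _ M(1)] xs
    by (simp add: outdeg_colors lpath_def card_ecols)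
qed

text \<open>Positions at which a rotation is possible. \<open>X\<close> holds further colours that
  must not enter the path, such as one that an earlier rotation removed.\<close>

definition newidx :: "'c set \<Rightarrow> 'a list \<Rightarrow> nat set" where
  "newidx X xs = {a. 0 < a \<and> a \<le> L \<and> adj (hd xs) (xs ! a) \<and> ecol (hd xs) (xs ! a) \<notin> set (ecols xs) \<union> X}"

lemma finite_newidx [simp]: "finite (newidx X xs)"
  by (rule finite_subset[of _ "{..L}"]) (auto simp: newidx_def)

lemma card_new_nbrs:
  assumes v: "v \<in> U" and C: "finite C"
  shows "real L + excess - card C \<le> card {w. adj v w \<and> ecol v w \<notin> C}"
proof -
  let ?A = "{w. adj v w \<and> ecol v w \<in> C}" and ?B = "{w. adj v w \<and> ecol v w \<notin> C}"
  have "card ?A = card (ecol v ` ?A)"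
    by (rule card_image[symmetric]) (auto simp: inj_on_def intro: ecol_inj)
  also have "\<dots> \<le> card C" by (intro card_mono C) auto
  finally have "card ?A \<le> card C" .
  moreover have "card {w. adj v w} = card ?A + card ?B"
    by (subst card_Un_disjoint[symmetric]) (auto intro: arg_cong[where f=card])
  ultimately show ?thesis using degree[OF v] by linarith
qed

text \<open>By \<open>outside_color\<close>, all neighbours in new colours lie on the path, so the
  surplus of the degree over the forbidden colours appears as positions.\<close>

lemma card_newidx:
  assumes xs: "lpath xs" and X: "finite X"
  shows "excess - card X \<le> card (newidx X xs)"
proof -
  let ?N = "{w. adj (hd xs) w \<and> ecol (hd xs) w \<notin> set (ecols xs) \<union> X}"
  have "?N \<subseteq> (!) xs ` newidx X xs"
  proof
    fix w assume w: "w \<in> ?N"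
    then have "w \<in> set xs" using outside_color[OF xs] by auto
    then obtain i where i: "i < length xs" "w = xs ! i" by (auto simp: in_set_conv_nth)
    have "i \<noteq> 0" using w i adj_neq[of "hd xs" w] lpath_nonempty[OF xs] by (metis (mono_tags) hd_conv_nth mem_Collect_eq)
    then show "w \<in> (!) xs ` newidx X xs" using w i xs by (auto simp: newidx_def lpath_def)
  qed
  then have "card ?N \<le> card ((!) xs ` newidx X xs)" by (intro card_mono) auto
  also have "\<dots> \<le> card (newidx X xs)" by (intro card_image_le) auto
  finally have 1: "card ?N \<le> card (newidx X xs)" .
  have "card (set (ecols xs) \<union> X) \<le> L + card X"
    using card_Un_le[of "set (ecols xs)" X] xs by (simp add: lpath_def card_ecols)
  moreover have "real L + excess - card (set (ecols xs) \<union> X) \<le> card ?N"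
    using card_new_nbrs[OF lpath_hd[OF xs], of "set (ecols xs) \<union> X"] X by simp
  ultimately show ?thesis using 1 by linarith
qed

lemma rot_lpath:
  assumes xs: "lpath xs" and a: "a \<in> newidx X xs"
  shows "lpath (rot a xs)" "hd (rot a xs) = xs ! (a - 1)" "last (rot a xs) = last xs"
    "set (ecols (rot a xs)) = insert (ecol (hd xs) (xs ! a)) (set (ecols xs) - {ecol (xs ! (a - 1)) (xs ! a)})"
    "ecol (xs ! (a - 1)) (xs ! a) \<in> set (ecols xs)"
    "ecol (xs ! (a - 1)) (xs ! a) \<notin> set (ecols (rot a xs))"
proof -
  have r: "rpath xs" and a': "0 < a" "a < length xs" "adj (hd xs) (xs ! a)" "ecol (hd xs) (xs ! a) \<notin> set (ecols xs)"
    using xs a by (auto simp: lpath_def newidx_def)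
  show "lpath (rot a xs)" using rot_path(1)[OF r a'] xs by (simp add: lpath_def)
  show "hd (rot a xs) = xs ! (a - 1)" "last (rot a xs) = last xs" using a' by (auto simp: hd_rot last_rot)
  show 1: "ecol (xs ! (a - 1)) (xs ! a) \<in> set (ecols xs)" using ecol_nth_mem[of "a-1" xs] a' by simp
  show 2: "set (ecols (rot a xs)) = insert (ecol (hd xs) (xs ! a)) (set (ecols xs) - {ecol (xs ! (a - 1)) (xs ! a)})"
    by (rule rot_path(2)[OF r a'])
  show "ecol (xs ! (a - 1)) (xs ! a) \<notin> set (ecols (rot a xs))" using 1 2 a'(4) by auto
qed

lemma removed_color_inj:
  assumes "lpath xs"
  shows "inj_on (\<lambda>a. ecol (xs ! (a - 1)) (xs ! a)) {0<..L}"
proof (rule inj_onI)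
  fix a b assume "a \<in> {0<..L}" "b \<in> {0<..L}" "ecol (xs ! (a - 1)) (xs ! a) = ecol (xs ! (b - 1)) (xs ! b)"
  then show "a = b" using nth_ecol_inj[of xs "a-1" "b-1"] assms by (auto simp: lpath_def)
qed

lemma newidx_sub: "newidx X xs \<subseteq> {0<..L}" by (auto simp: newidx_def)

text \<open>Rotations at the opposite end keep \<open>hd xs\<close> and remove pairwise different
  path colours.\<close>

lemma outdeg_end:
  assumes xs: "lpath xs"
  shows "outdeg (set xs) (hd xs) + card (newidx {} (rev xs)) \<le> L"
proof -
  let ?y = "rev xs" let ?f = "\<lambda>a. ecol (?y ! (a - 1)) (?y ! a)"
  have ly: "lpath ?y" using xs by simp
  have "outdeg (set xs) (hd xs) + card (?f ` newidx {} ?y) \<le> L"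
  proof (rule outdeg_le[OF xs])
    show "?f ` newidx {} ?y \<subseteq> set (ecols xs)"
      using rot_lpath(5)[OF ly] by (auto simp: ecols_rev)
    fix c assume "c \<in> ?f ` newidx {} ?y"
    then obtain a where a: "a \<in> newidx {} ?y" "c = ?f a" by auto
    have "hd (rev (rot a ?y)) = hd xs" using rot_lpath(3)[OF ly a(1)] lpath_nonempty[OF xs]
      by (simp add: hd_rev last_rev)
    then show "\<exists>ys. lpath ys \<and> set ys = set xs \<and> hd ys = hd xs \<and> c \<notin> set (ecols ys)"
      using rot_lpath[OF ly a(1)] a(2) by (intro exI[of _ "rev (rot a ?y)"]) (auto simp: ecols_rev)
  qed
  moreover have "card (?f ` newidx {} ?y) = card (newidx {} ?y)"
    using removed_color_inj[OF ly] newidx_sub by (intro card_image) (rule inj_on_subset)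
  ultimately show ?thesis by simp
qed

lemma outdeg_end_excess: "lpath xs \<Longrightarrow> outdeg (set xs) (hd xs) \<le> L - excess"
  using outdeg_end[of xs] card_newidx[of "rev xs" "{}"] by simp

lemma outdeg_ge:
  assumes xs: "lpath xs"
  shows "excess \<le> outdeg (set xs) (hd xs)"
proof -
  let ?v = "hd xs"
  have "{w. adj ?v w} \<subseteq> {w. adj ?v w \<and> w \<notin> set xs} \<union> (set xs - {?v})"
    using adj_neq by auto
  then have "card {w. adj ?v w} \<le> card ({w. adj ?v w \<and> w \<notin> set xs} \<union> (set xs - {?v}))"
    by (intro card_mono) auto
  also have "\<dots> \<le> outdeg (set xs) ?v + card (set xs - {?v})"
    unfolding outdeg_def by (rule card_Un_le)
  also have "card (set xs - {?v}) = L" using lpath_card[OF xs] lpath_nonempty[OF xs] by simp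
  finally show ?thesis using degree[OF lpath_hd[OF xs]] by linarith
qed

text \<open>An edge touching \<open>S\<close> leaves \<open>V\<close> or is a pair in
  \<open>V\<close> not contained in \<open>V - S\<close>. With \<open>s = card S\<close> there are
  \<open>(L + 1 choose 2) - (L + 1 - s choose 2) = s * L - s * (s - 1) / 2\<close> such
  pairs.\<close>

lemma touching_le:
  assumes V: "V \<subseteq> U" "card V = Suc L" and S: "S \<subseteq> V"
  shows "real (card {e \<in> E. e \<inter> S \<noteq> {}}) \<le> (\<Sum>v\<in>S. real (outdeg V v)) + card S * L - card S * (real (card S) - 1) / 2"
proof -
  have fV: "finite V" using V finite_verts finite_subset by blast
  have fS: "finite S" using S fV finite_subset by blast
  let ?Out = "\<Union>v\<in>S. (\<lambda>w. {v, w}) ` {w. adj v w \<and> w \<notin> V}"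
  let ?P = "\<lambda>A. {e. e \<subseteq> A \<and> card e = 2}"
  have fP: "finite (?P A)" if "finite A" for A :: "'a set" using that by (auto intro: finite_subset[of _ "Pow A"])
  have "{e \<in> E. e \<inter> S \<noteq> {}} \<subseteq> ?Out \<union> (?P V - ?P (V - S))"
  proof
    fix e assume e: "e \<in> {e \<in> E. e \<inter> S \<noteq> {}}"
    then obtain v where v: "v \<in> e" "v \<in> S" by auto
    then obtain w where w: "e = {v, w}" "v \<noteq> w" using edge_pair e by blast
    show "e \<in> ?Out \<union> (?P V - ?P (V - S))"
    proof (cases "w \<in> V")
      case True then show ?thesis using w v S e by auto
    next
      case False then show ?thesis using w v e by auto
    qed
  qed
  then have "card {e \<in> E. e \<inter> S \<noteq> {}} \<le> card (?Out \<union> (?P V - ?P (V - S)))"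
    using fP[OF fV] fS by (intro card_mono) auto
  also have "\<dots> \<le> card ?Out + card (?P V - ?P (V - S))" by (rule card_Un_le)
  also have "card (?P V - ?P (V - S)) = card (?P V) - card (?P (V - S))"
    using fP fV by (intro card_Diff_subset) auto
  also have "card ?Out \<le> (\<Sum>v\<in>S. outdeg V v)"
    unfolding outdeg_def
    by (rule order_trans[OF card_UN_le[OF fS]]) (auto intro!: sum_mono card_image_le)
  finally have 1: "card {e \<in> E. e \<inter> S \<noteq> {}} \<le> (\<Sum>v\<in>S. outdeg V v) + (card (?P V) - card (?P (V - S)))"
    by simp
  have cS: "card S \<le> Suc L" using V S card_mono[OF fV] by metis
  have ch: "real (n choose 2) = real n * (real n - 1) / 2" for n
    by (cases n) (auto simp: choose_two algebra_simps real_of_nat_div)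
  have "card (V - S) = Suc L - card S" using V S fS by (simp add: card_Diff_subset)
  then have "real (card (?P V)) = real (Suc L) * real L / 2"
     "real (card (?P (V - S))) = (real (Suc L) - card S) * (real L - card S) / 2"
    using n_subsets[OF fV, of 2] n_subsets[of "V - S" 2] fV V cS
    by (simp_all add: ch of_nat_diff)
  moreover have "card (?P (V - S)) \<le> card (?P V)" using fP[OF fV] by (intro card_mono) auto
  ultimately have "real (card (?P V) - card (?P (V - S))) = real (Suc L) * real L / 2 - (real (Suc L) - card S) * (real L - card S) / 2"
    by (simp add: of_nat_diff)
  also have "\<dots> = card S * L - card S * (real (card S) - 1) / 2" by (simp add: field_simps)
  finally have 2: "real (card (?P V) - card (?P (V - S))) = card S * L - card S * (real (card S) - 1) / 2" .
  show ?thesis using 1[THEN of_nat_mono, where 'a=real] unfolding of_nat_add 2 by simp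
qed

lemma touching_main:
  assumes V: "V \<subseteq> U" "card V = Suc L" and S: "S \<subseteq> V" "S \<noteq> {}"
  shows "(9 * real L / 7 + 2) * card S \<le> (\<Sum>v\<in>S. real (outdeg V v)) + card S * L - card S * (real (card S) - 1) / 2"
  using touching_le[OF V S(1)] touching[of S] V S by force

lemma lpath_sub: "lpath xs \<Longrightarrow> set xs \<subseteq> U" by (simp add: lpath_def rpath_def)

text \<open>The out-degree of an end lies between \<open>excess\<close> and
  \<open>L - excess\<close>, so \<open>2 * excess \<le> L\<close>.\<close>

lemma L_large: "lpath xs \<Longrightarrow> 28 / 3 \<le> real L"
  using outdeg_end_excess[of xs] outdeg_ge[of xs] unfolding excess_def by linarith

subsection \<open>Rainbow cycles through all vertices of the path\<close>

text \<open>Position \<open>L\<close> is the other end, so the path would close to a rainbow cycle.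
  Opened anywhere, the cycle makes every vertex an end; hence all out-degrees are at most
  \<open>L - excess\<close>.\<close>

lemma no_hamiltonian_rainbow_cycle:
  assumes xs: "lpath xs"
  shows "L \<notin> newidx X xs"
proof
  assume L: "L \<in> newidx X xs"
  let ?V = "set xs"
  have len: "length xs = Suc L" and r: "rpath xs" using xs by (auto simp: lpath_def)
  have last: "last xs = xs ! L" using len by (cases xs rule: rev_cases) auto
  have cl: "adj (last xs) (hd xs)" "ecol (last xs) (hd xs) \<notin> set (ecols xs)"
    using L by (auto simp: newidx_def last adj_commute ecol_commute)
  have "real (outdeg ?V v) \<le> L - excess" if "v \<in> ?V" for v
  proof -
    from split_list[OF that] obtain p q where pq: "xs = p @ v # q" by blast
    have "rpath ((v # q) @ p)"
    proof (cases "p = []")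
      case False
      then show ?thesis using rpath_swap[of p "v # q"] r cl unfolding pq by auto
    qed (use r pq in simp)
    then have "lpath ((v # q) @ p)" using len pq by (simp add: lpath_def)
    from outdeg_end_excess[OF this] show ?thesis by (simp add: pq Un_commute insert_commute)
  qed
  then have "(\<Sum>v\<in>?V. real (outdeg ?V v)) \<le> (\<Sum>v\<in>?V. L - excess)" by (rule sum_mono)
  then have 1: "(\<Sum>v\<in>?V. real (outdeg ?V v)) \<le> real (card ?V) * (L - excess)" by simp
  have "?V \<noteq> {}" using lpath_nonempty[OF xs] by simp
  from touching_main[OF lpath_sub[OF xs] lpath_card[OF xs] order_refl this]
  have "real (card ?V) * (9 * real L / 7 + 2) \<le> (\<Sum>v\<in>?V. real (outdeg ?V v)) + card ?V * L - card ?V * real L / 2"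
    by (simp add: lpath_card[OF xs] mult.commute)
  then have "real (Suc L) * (9 * real L / 7 + 2) \<le> real (Suc L) * (L - excess + L - real L / 2)"
    using 1 unfolding lpath_card[OF xs] of_nat_mult ring_distribs right_diff_distrib times_divide_eq_right by linarith
  \<comment> \<open>The right-hand side is \<open>17 * L / 14 - 2\<close>, while
    \<open>9 / 7 = 18 / 14\<close>.\<close>
  then have "9 * real L / 7 + 2 \<le> L - excess + L - real L / 2" by (subst (asm) mult_le_cancel_left_pos) auto
  then show False unfolding excess_def by linarith
qed

subsection \<open>Double counting without long rainbow cycles\<close>

definition lastidx :: "'c set \<Rightarrow> 'a list \<Rightarrow> nat set" where
  "lastidx X xs = {b. b < L \<and> adj (last xs) (xs ! b) \<and> ecol (last xs) (xs ! b) \<notin> set (ecols xs) \<union> X}"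

text \<open>The mirror image of \<open>rot\<close>: the chord from the last vertex to
  \<open>xs ! b\<close> replaces the edge between positions \<open>b\<close> and
  \<open>b + 1\<close>, and \<open>xs ! Suc b\<close> becomes the last vertex.\<close>

definition rotr :: "nat \<Rightarrow> 'a list \<Rightarrow> 'a list" where
  "rotr b xs = take (Suc b) xs @ rev (drop (Suc b) xs)"

lemma finite_lastidx [simp]: "finite (lastidx X xs)"
  by (rule finite_subset[of _ "{..L}"]) (auto simp: lastidx_def)

lemma newidx_rev:
  assumes "lpath xs"
  shows "newidx X (rev xs) = (\<lambda>b. L - b) ` lastidx X xs"
proof -
  have l: "length xs = Suc L" "xs \<noteq> []" using assms by (auto simp: lpath_def)
  have n: "rev xs ! a = xs ! (L - a)" if "a \<le> L" for a using that l by (simp add: rev_nth)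
  have "a \<in> newidx X (rev xs) \<longleftrightarrow> a \<le> L \<and> 0 < a \<and> L - a \<in> lastidx X xs" for a
    using n[of a] l by (auto simp: newidx_def lastidx_def hd_rev ecols_rev)
  moreover have "lastidx X xs \<subseteq> {..<L}" by (auto simp: lastidx_def)
  ultimately show ?thesis
    by (auto simp: image_iff subset_iff) (metis diff_diff_cancel)
qed

lemma card_lastidx_rev: "lpath xs \<Longrightarrow> card (newidx X (rev xs)) = card (lastidx X xs)"
  unfolding newidx_rev by (rule card_image) (auto simp: inj_on_def lastidx_def)

lemma card_newidx_rev: "lpath xs \<Longrightarrow> card (lastidx X (rev xs)) = card (newidx X xs)"
  using card_lastidx_rev[of "rev xs" X] by simp

lemma card_lastidx: "lpath xs \<Longrightarrow> finite X \<Longrightarrow> excess - card X \<le> card (lastidx X xs)"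
  using card_newidx[of "rev xs" X] by (simp add: card_lastidx_rev)

lemma rotr_rev: "length xs = Suc L \<Longrightarrow> b < L \<Longrightarrow> rotr b xs = rev (rot (L - b) (rev xs))"
  by (simp add: rotr_def rot_def take_rev drop_rev Suc_diff_le)

lemma nth_rotr:
  assumes "length xs = Suc L" "b < L" "i \<le> L"
  shows "rotr b xs ! i = (if i \<le> b then xs ! i else xs ! (L + b + 1 - i))"
  using assms by (auto simp: rotr_def nth_append rev_nth min_def intro!: arg_cong[where f="(!) xs"])

lemma rotr_lpath:
  assumes xs: "lpath xs" and b: "b \<in> lastidx X xs"
  shows "lpath (rotr b xs)" "hd (rotr b xs) = hd xs" "last (rotr b xs) = xs ! Suc b" "set (rotr b xs) = set xs"
    "set (ecols (rotr b xs)) = insert (ecol (last xs) (xs ! b)) (set (ecols xs) - {ecol (xs ! b) (xs ! Suc b)})"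
    "ecol (xs ! b) (xs ! Suc b) \<in> set (ecols xs)"
    "ecol (xs ! b) (xs ! Suc b) \<notin> set (ecols (rotr b xs))"
proof -
  have l: "length xs = Suc L" "xs \<noteq> []" using xs by (auto simp: lpath_def)
  have bL: "b < L" using b by (auto simp: lastidx_def)
  have lr: "lpath (rev xs)" and a: "L - b \<in> newidx X (rev xs)" using xs b by (auto simp: newidx_rev)
  have n: "rev xs ! (L - b - 1) = xs ! Suc b" "rev xs ! (L - b) = xs ! b" using l bL by (auto simp: rev_nth Suc_diff_Suc)
  have e: "rotr b xs = rev (rot (L - b) (rev xs))" using rotr_rev l bL by simp
  have ne: "rot (L - b) (rev xs) \<noteq> []" using l length_rot[of "L-b" "rev xs"] by force
  note r = rot_lpath[OF lr a, unfolded n]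
  show "lpath (rotr b xs)" "hd (rotr b xs) = hd xs" "last (rotr b xs) = xs ! Suc b" "set (rotr b xs) = set xs"
    using r(1,2,3) ne l unfolding e by (auto simp: hd_rev last_rev)
  show "set (ecols (rotr b xs)) = insert (ecol (last xs) (xs ! b)) (set (ecols xs) - {ecol (xs ! b) (xs ! Suc b)})"
    "ecol (xs ! b) (xs ! Suc b) \<in> set (ecols xs)"
    "ecol (xs ! b) (xs ! Suc b) \<notin> set (ecols (rotr b xs))"
    using r(4,5,6) l unfolding e by (auto simp: ecols_rev hd_rev ecol_commute)
qed

lemma newidx_ge2:
  assumes xs: "lpath xs" and a: "a \<in> newidx X xs"
  shows "2 \<le> a"
proof (rule ccontr)
  assume "\<not> 2 \<le> a"
  then have "a = 1" using a by (auto simp: newidx_def)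
  moreover have "hd xs = xs ! 0" using lpath_nonempty[OF xs] by (simp add: hd_conv_nth)
  ultimately show False using a ecol_nth_mem[of 0 xs] xs by (auto simp: newidx_def lpath_def)
qed

lemma lastidx_le:
  assumes xs: "lpath xs" and b: "b \<in> lastidx X xs"
  shows "b + 2 \<le> L"
proof -
  have "L - b \<in> newidx X (rev xs)" using newidx_rev[OF xs] b by auto
  then have "2 \<le> L - b" using newidx_ge2[of "rev xs"] xs by simp
  then show ?thesis by simp
qed

text \<open>With different colours, the case \<open>j = 1\<close> closes a rainbow cycle through all vertices of the path,
  and \<open>j = 2\<close> one through all but a single pendant vertex.\<close>

lemma coincidence_color:
  assumes xs: "lpath xs" and no: "\<And>ys. lpath ys \<Longrightarrow> L - 1 \<notin> newidx {} ys"
    and j: "j \<in> {1, 2}" and b: "b \<in> lastidx X xs" "b + j \<in> newidx X xs"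
  shows "ecol (hd xs) (xs ! (b + j)) = ecol (last xs) (xs ! b)"
proof (rule ccontr)
  assume ne: "ecol (hd xs) (xs ! (b + j)) \<noteq> ecol (last xs) (xs ! b)"
  have l: "length xs = Suc L" using xs by (auto simp: lpath_def)
  have bL: "b < L" "b + j \<le> L" using b by (auto simp: lastidx_def newidx_def)
  note r = rotr_lpath[OF xs b(1)]
  \<comment> \<open>The rotation moves \<open>xs ! (b + j)\<close> to the last position for
    \<open>j = 1\<close> and to the one before it for \<open>j = 2\<close>.\<close>
  have "rotr b xs ! (L + 1 - j) = xs ! (b + j)"
    using nth_rotr[of xs b "L + 1 - j"] l bL j by (auto simp: algebra_simps)
  then have "L + 1 - j \<in> newidx {} (rotr b xs)"
    using b(2) ne j bL unfolding newidx_def by (auto simp: r)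
  then show False using no[OF r(1)] no_hamiltonian_rainbow_cycle[OF r(1)] j by auto
qed

text \<open>The overlap of the rotations at the two ends: for \<open>j = 1\<close> they remove the
  same edge, for \<open>j = 2\<close> they produce the same new end.\<close>

definition coinc :: "nat \<Rightarrow> 'c set \<Rightarrow> 'a list \<Rightarrow> nat set" where
  "coinc j X xs = {b \<in> lastidx X xs. b + j \<in> newidx X xs}"

lemma finite_coinc [simp]: "finite (coinc j X xs)" by (simp add: coinc_def)

text \<open>A coincidence in \<open>rot a w\<close> fixes the new end \<open>w ! (a - 1)\<close> as the neighbour of a known vertex in
  a known colour, so each pair of positions contributes for at most one \<open>a\<close>.\<close>

lemma few_coincidences_rot:
  assumes w: "lpath w" and no: "\<And>ys. lpath ys \<Longrightarrow> L - 1 \<notin> newidx {} ys"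
    and j: "j \<in> {1, 2}" and ne: "newidx X w \<noteq> {}" 
    and le: "card (lastidx X w) \<le> card (newidx X w)"
  shows "\<exists>a\<in>newidx X w. card (coinc j X (rot a w)) \<le> 2 + j"
proof (rule ccontr)
  assume "\<not> ?thesis"
  then have big: "3 + j \<le> card (coinc j X (rot a w))" if "a \<in> newidx X w" for a using that by force
  let ?A = "newidx X w" and ?B = "lastidx X w"
  \<comment> \<open>All positions \<open>a\<close> are counted at once: if every rotation had too
    many coincidences, \<open>P\<close> would have at least \<open>(3 + j) * card ?A\<close>
    elements.\<close>
  define P where "P = (SIGMA a:?A. coinc j X (rot a w))"
  have finP: "finite P" by (simp add: P_def)
  have "(3 + j) * card ?A \<le> (\<Sum>a\<in>?A. card (coinc j X (rot a w)))"
    using sum_mono[of ?A "\<lambda>_. 3 + j", OF big] by (simp add: mult.commute)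
  also have "\<dots> = card P" by (simp add: P_def)
  finally have low: "(3 + j) * card ?A \<le> card P" .
  have lw: "length w = Suc L" and rw: "rpath w" using w by (auto simp: lpath_def)
  have dw: "distinct w" using rw by (simp add: rpath_def)
  have inP: "a \<in> ?A \<and> a \<le> L \<and> 0 < a \<and> b < L \<and> b + j \<le> L
      \<and> adj (last w) (rot a w ! b) \<and> adj (w ! (a - 1)) (rot a w ! (b + j)) 
      \<and> ecol (w ! (a - 1)) (rot a w ! (b + j)) = ecol (last w) (rot a w ! b)
      \<and> (b + j \<noteq> a \<longrightarrow> ecol (last w) (rot a w ! b) \<notin> set (ecols w) \<union> X)" if ab: "(a, b) \<in> P" for a b
  proof -
    have a: "a \<in> ?A" "a \<le> L" "0 < a" and b: "b \<in> lastidx X (rot a w)" "b + j \<in> newidx X (rot a w)"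
      using ab by (auto simp: P_def coinc_def newidx_def)
    note r = rot_lpath[OF w a(1)]
    have eq: "ecol (w ! (a - 1)) (rot a w ! (b + j)) = ecol (last w) (rot a w ! b)"
      using coincidence_color[OF r(1) no j b] r by simp
    have bb: "b < L" "b + j \<le> L" "adj (last w) (rot a w ! b)" "adj (w ! (a - 1)) (rot a w ! (b + j))"
      "ecol (last w) (rot a w ! b) \<notin> set (ecols (rot a w)) \<union> X"
      using b r by (auto simp: lastidx_def newidx_def)
    \<comment> \<open>The only colour of \<open>w\<close> that the rotation frees is that of the
      edge from \<open>w ! (a - 1)\<close> to \<open>w ! a\<close>. A coincidence can use it only if
      \<open>b + j = a\<close>.\<close>
    have "ecol (last w) (rot a w ! b) \<notin> set (ecols w) \<union> X" if "b + j \<noteq> a"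
    proof
      assume "ecol (last w) (rot a w ! b) \<in> set (ecols w) \<union> X"
      then have "ecol (last w) (rot a w ! b) = ecol (w ! (a - 1)) (w ! a)" using bb r(4) by auto
      then have "ecol (w ! (a - 1)) (rot a w ! (b + j)) = ecol (w ! (a - 1)) (w ! a)" using eq by simp
      moreover have "adj (w ! (a - 1)) (w ! a)" 
        using rw lw a by (auto simp: rpath_def successively_conv_nth dest: spec[of _ "a - 1"])
      ultimately have "rot a w ! (b + j) = w ! a" using ecol_inj bb by blast
      also have "w ! a = rot a w ! a" using nth_rot[of a w a] a lw by simp
      finally have "b + j = a" using bb a lw nth_eq_iff_index_eq[of "rot a w" "b + j" a] r(1)
        by (auto simp: lpath_def rpath_def)
      then show False using that by simp
    qed
    then show ?thesis using a bb eq by auto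
  qed
  \<comment> \<open>Both positions lie in the reversed part, or both in the unchanged part, or they
    straddle the cut.\<close>
  define P1 where "P1 = {(a, b) \<in> P. b + j < a}"
  define P2 where "P2 = {(a, b) \<in> P. a \<le> b}"
  define P3 where "P3 = {(a, b) \<in> P. b < a \<and> a \<le> b + j}"
  have P: "P = P1 \<union> P2 \<union> P3" by (auto simp: P1_def P2_def P3_def)
  have fin: "finite P1" "finite P2" "finite P3" using finP P by auto
  have recover: "a = a'" if "(a, b) \<in> P" "(a', b') \<in> P" "rot a w ! b = rot a' w ! b'"
     "rot a w ! (b + j) = rot a' w ! (b' + j)" for a b a' b'
  proof -
    have "w ! (a - 1) = w ! (a' - 1)" 
      using inP[OF that(1)] inP[OF that(2)] that(3,4) ecol_inj'[of "w ! (a - 1)" "rot a w ! (b + j)" "w ! (a' - 1)"] by auto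
    then have "a - 1 = a' - 1" using inP[OF that(1)] inP[OF that(2)] dw lw by (subst (asm) nth_eq_iff_index_eq) auto
    moreover have "0 < a" "0 < a'" using inP[OF that(1)] inP[OF that(2)] by blast+
    ultimately show ?thesis by linarith
  qed
  have n1: "rot a w ! b = w ! (a - 1 - b)" "rot a w ! (b + j) = w ! (a - 1 - b - j)" if "(a, b) \<in> P1" for a b
    using that inP[of a b] lw nth_rot[of a w b] nth_rot[of a w "b + j"] by (auto simp: P1_def algebra_simps)
  have n2: "rot a w ! b = w ! b" "rot a w ! (b + j) = w ! (b + j)" if "(a, b) \<in> P2" for a b
    using that inP[of a b] lw nth_rot[of a w b] nth_rot[of a w "b + j"] by (auto simp: P2_def)
  \<comment> \<open>In \<open>w\<close> itself the vertex at position \<open>b\<close> stands at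
    \<open>a - 1 - b\<close> and is still reached from \<open>last w\<close> in a new
    colour.\<close>
  have "card P1 \<le> card ?B"
  proof (rule card_inj_on_le[of "\<lambda>(a, b). a - 1 - b"])
    show "inj_on (\<lambda>(a, b). a - 1 - b) P1"
    proof (rule inj_onI, clarify)
      fix a b a' b' assume m: "(a, b) \<in> P1" "(a', b') \<in> P1" and e: "a - 1 - b = a' - 1 - b'"
      have "rot a w ! b = rot a' w ! b'" "rot a w ! (b + j) = rot a' w ! (b' + j)"
        unfolding n1[OF m(1)] n1[OF m(2)] e by (rule refl)+
      then have "a = a'" using recover[of a b a' b'] m by (auto simp: P1_def)
      then show "a = a' \<and> b = b'" using e m by (auto simp: P1_def)
    qed
    show "(\<lambda>(a, b). a - 1 - b) ` P1 \<subseteq> ?B"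
    proof clarify
      fix a b assume m: "(a, b) \<in> P1"
      show "a - 1 - b \<in> ?B" using n1[OF m] m inP[of a b] by (auto simp: P1_def lastidx_def)
    qed
  qed simp
  moreover have "card P2 \<le> card ?B"
  proof (rule card_inj_on_le[of snd])
    show "inj_on snd P2"
    proof (rule inj_onI, clarsimp)
      fix a a' b assume m: "(a, b) \<in> P2" "(a', b) \<in> P2"
      show "a = a'" using recover[of a b a' b] n2[OF m(1)] n2[OF m(2)] m by (auto simp: P2_def)
    qed
    show "snd ` P2 \<subseteq> ?B"
    proof clarsimp
      fix a b assume m: "(a, b) \<in> P2"
      show "b \<in> ?B" using n2[OF m] m inP[of a b] j by (auto simp: P2_def lastidx_def)
    qed
  qed simp
  \<comment> \<open>For a given \<open>a\<close>, only the \<open>j\<close> values of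
    \<open>b\<close> just below \<open>a\<close> straddle the cut.\<close>
  moreover have "card P3 \<le> card (?A \<times> {..<j})"
  proof (rule card_inj_on_le[of "\<lambda>(a, b). (a, a - 1 - b)"])
    show "inj_on (\<lambda>(a, b). (a, a - 1 - b)) P3" by (auto simp: inj_on_def P3_def)
    show "(\<lambda>(a, b). (a, a - 1 - b)) ` P3 \<subseteq> ?A \<times> {..<j}" by (auto simp: P3_def P_def)
  qed simp
  moreover have "card P \<le> card P1 + card P2 + card P3"
    unfolding P by (meson card_Un_le le_trans add_mono order_refl)
  ultimately have "card P \<le> (2 + j) * card ?A" using le by (simp add: algebra_simps)
  moreover have "0 < card ?A" using ne by (simp add: card_gt_0_iff)
  ultimately show False using low by (simp add: algebra_simps)
qed

text \<open>A rotation adds a single colour. With \<open>C\<close> the colours of a reference path,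
  this limits how far repeated rotations drift from it.\<close>

lemma card_ecols_rot:
  assumes "lpath xs" "a \<in> newidx X xs"
  shows "card (set (ecols (rot a xs)) - C) \<le> Suc (card (set (ecols xs) - C))"
proof -
  have "set (ecols (rot a xs)) - C \<subseteq> insert (ecol (hd xs) (xs ! a)) (set (ecols xs) - C)"
    using rot_lpath(4)[OF assms] by auto
  then have "card (set (ecols (rot a xs)) - C) \<le> card (insert (ecol (hd xs) (xs ! a)) (set (ecols xs) - C))"
    by (intro card_mono) auto
  also have "\<dots> \<le> Suc (card (set (ecols xs) - C))" by (simp add: card_insert_if)
  finally show ?thesis .
qed

lemma card_ecols_rotr:
  assumes "lpath xs" "b \<in> lastidx X xs"
  shows "card (set (ecols (rotr b xs)) - C) \<le> Suc (card (set (ecols xs) - C))"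
proof -
  have "set (ecols (rotr b xs)) - C \<subseteq> insert (ecol (last xs) (xs ! b)) (set (ecols xs) - C)"
    using rotr_lpath(5)[OF assms] by auto
  then have "card (set (ecols (rotr b xs)) - C) \<le> card (insert (ecol (last xs) (xs ! b)) (set (ecols xs) - C))"
    by (intro card_mono) auto
  also have "\<dots> \<le> Suc (card (set (ecols xs) - C))" by (simp add: card_insert_if)
  finally show ?thesis .
qed

text \<open>Reversing the path if necessary, the first vertex has at least as many rotation
  positions as the last, as \<open>few_coincidences_rot\<close> requires. Its rotation costs one
  more colour outside \<open>C\<close>.\<close>

lemma few_coincidences:
  assumes w: "lpath w" "set (ecols w) \<inter> X = {}" and no: "\<And>ys. lpath ys \<Longrightarrow> L - 1 \<notin> newidx {} ys"
    and j: "j \<in> {1, 2}" and X: "finite X" "card X < excess"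
  shows "\<exists>w'. lpath w' \<and> set w' = set w \<and> set (ecols w') \<inter> X = {}
    \<and> card (set (ecols w') - C) \<le> Suc (card (set (ecols w) - C)) \<and> card (coinc j X w') \<le> 2 + j"
proof -
  have main: "\<exists>w'. lpath w' \<and> set w' = set w \<and> set (ecols w') \<inter> X = {}
    \<and> card (set (ecols w') - C) \<le> Suc (card (set (ecols w) - C)) \<and> card (coinc j X w') \<le> 2 + j"
    if v: "lpath v" "set (ecols v) = set (ecols w)" "set v = set w" "card (lastidx X v) \<le> card (newidx X v)" for v
  proof -
    have "0 < card (newidx X v)" using card_newidx[OF v(1) X(1)] X(2) by linarith
    then have "newidx X v \<noteq> {}" by auto
    then obtain a where a: "a \<in> newidx X v" "card (coinc j X (rot a v)) \<le> 2 + j"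
      using few_coincidences_rot[OF v(1) no j _ v(4)] by blast
    have "set (ecols (rot a v)) \<inter> X = {}"
      using rot_lpath(4)[OF v(1) a(1)] w(2) v(2) a(1) by (auto simp: newidx_def)
    then show ?thesis using a rot_lpath[OF v(1) a(1)] card_ecols_rot[OF v(1) a(1), of C] v
      by (intro exI[of _ "rot a v"]) simp
  qed
  show ?thesis
  proof (cases "card (lastidx X w) \<le> card (newidx X w)")
    case True
    then show ?thesis using main[of w] w by simp
  next
    case False
    then show ?thesis using main[of "rev w"] w by (simp add: ecols_rev card_lastidx_rev card_newidx_rev)
  qed
qed

text \<open>An edge is indexed by its later vertex, so that rotations at both ends refer to edges in
  the same way: position \<open>a\<close> at the first end, \<open>Suc b\<close> at the
  last.\<close>

lemma missing_path_rot:
  assumes xs: "lpath xs" and i: "i \<in> newidx {} xs \<union> Suc ` lastidx {} xs"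
  shows "\<exists>ys. lpath ys \<and> set ys = set xs \<and> ecol (xs ! (i - 1)) (xs ! i) \<notin> set (ecols ys)
    \<and> card (set (ecols ys) - C) \<le> Suc (card (set (ecols xs) - C))"
  using i
proof
  assume i: "i \<in> newidx {} xs"
  show ?thesis using rot_lpath[OF xs i] card_ecols_rot[OF xs i] by (intro exI[of _ "rot i xs"]) simp
next
  assume "i \<in> Suc ` lastidx {} xs"
  then obtain b where b: "b \<in> lastidx {} xs" "i = Suc b" by auto
  show ?thesis using rotr_lpath[OF xs b(1)] card_ecols_rotr[OF xs b(1)] b(2) 
    by (intro exI[of _ "rotr b xs"]) simp
qed

text \<open>One rotation leads to a path \<open>u\<close> with at most 4 coincidences for
  \<open>j = 2\<close>. Rotations of \<open>u\<close> avoiding \<open>c\<close> give at least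
  \<open>excess - 1\<close> new ends on each side. With the two ends of \<open>u\<close> and minus
  the coincidences this makes \<open>2 * (excess - 1) + 2 - 4\<close>. The number of colours outside
  \<open>C\<close> grows from 1 over 2 to 3.\<close>

lemma card_missing_ends:
  assumes w: "lpath w" "c \<notin> set (ecols w)" and no: "\<And>ys. lpath ys \<Longrightarrow> L - 1 \<notin> newidx {} ys"
    and C: "card (set (ecols w) - C) \<le> 1"
  shows "2 * excess - 4 \<le> card {v. \<exists>ys. lpath ys \<and> set ys = set w \<and> hd ys = v \<and> c \<notin> set (ecols ys)
     \<and> card (set (ecols ys) - C) \<le> 3}" (is "_ \<le> real (card ?S)")
proof -
  have "real (card {c}) < excess" by (simp add: excess_def)
  then obtain u where u: "lpath u" "set u = set w" "c \<notin> set (ecols u)"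
    "card (set (ecols u) - C) \<le> 2" "card (coinc 2 {c} u) \<le> 4"
    using few_coincidences[OF w(1) _ no, of "{c}" 2 C] w(2) C by fastforce
  let ?A = "newidx {c} u" and ?B = "lastidx {c} u"
  let ?I = "(\<lambda>a. a - 1) ` ?A \<union> Suc ` ?B \<union> {0, L}"
  have lu: "length u = Suc L" and du: "distinct u" using u(1) by (auto simp: lpath_def rpath_def)
  have L0: "0 < L" using L_large[OF u(1)] by auto
  have lastu: "last u = u ! L" and hdu: "hd u = u ! 0" using lu by (auto simp: last_conv_nth hd_conv_nth simp flip: length_0_conv)
  have A2: "2 \<le> a" "a \<le> L" if "a \<in> ?A" for a using newidx_ge2[OF u(1) that] that by (auto simp: newidx_def)
  have B2: "b + 2 \<le> L" if "b \<in> ?B" for b using lastidx_le[OF u(1) that] .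
  have "(!) u ` ?I \<subseteq> ?S"
  proof clarify
    fix i assume "i \<in> ?I"
    then consider a where "a \<in> ?A" "i = a - 1" | b where "b \<in> ?B" "i = Suc b" | "i = 0" | "i = L" by auto
    then show "\<exists>ys. lpath ys \<and> set ys = set w \<and> hd ys = u ! i \<and> c \<notin> set (ecols ys) \<and> card (set (ecols ys) - C) \<le> 3"
    proof cases
      case (1 a)
      then show ?thesis using rot_lpath[OF u(1) 1(1)] card_ecols_rot[OF u(1) 1(1), of C] u
        by (intro exI[of _ "rot a u"]) (auto simp: newidx_def)
    next
      case (2 b)
      have "hd (rev (rotr b u)) = u ! i" using rotr_lpath[OF u(1) 2(1)] lpath_nonempty 2(2) by (simp add: hd_rev)
      then show ?thesis using rotr_lpath[OF u(1) 2(1)] card_ecols_rotr[OF u(1) 2(1), of C] u 2(1)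
        by (intro exI[of _ "rev (rotr b u)"]) (auto simp: lastidx_def ecols_rev)
    next
      case 3
      then show ?thesis using u hdu by (intro exI[of _ u]) auto
    next
      case 4
      then show ?thesis using u lastu by (intro exI[of _ "rev u"]) (auto simp: hd_rev ecols_rev)
    qed
  qed
  moreover have "?S \<subseteq> set w" using lpath_nonempty by auto
  then have "finite ?S" by (rule finite_subset) simp
  ultimately have "card ((!) u ` ?I) \<le> card ?S" by (intro card_mono)
  moreover have "card ((!) u ` ?I) = card ?I"
  proof (rule card_image, rule inj_onI)
    fix i j assume "i \<in> ?I" "j \<in> ?I" and e: "u ! i = u ! j"
    then have "i \<le> L" "j \<le> L" using A2 B2 by fastforce+
    then show "i = j" using e du lu by (simp add: nth_eq_iff_index_eq)
  qed
  \<comment> \<open>No rotation returns an old end, as \<open>newidx_ge2\<close> and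
    \<open>lastidx_le\<close> keep the new ends strictly between positions \<open>0\<close> and
    \<open>L\<close>.\<close>
  moreover have "card ?I = card ((\<lambda>a. a - 1) ` ?A \<union> Suc ` ?B) + 2"
  proof -
    have "0 \<notin> (\<lambda>a. a - 1) ` ?A \<union> Suc ` ?B" "L \<notin> (\<lambda>a. a - 1) ` ?A \<union> Suc ` ?B"
      using A2 B2 L0 by fastforce+
    then show ?thesis using L0 by (subst card_Un_disjoint) auto
  qed
  moreover have "card ((\<lambda>a. a - 1) ` ?A) = card ?A" by (rule card_image) (use A2 in \<open>fastforce simp: inj_on_def\<close>)
  moreover have "card (Suc ` ?B) = card ?B" by (rule card_image) simp
  moreover have "card ((\<lambda>a. a - 1) ` ?A \<inter> Suc ` ?B) \<le> 4"
  proof -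
    have "(\<lambda>a. a - 1) ` ?A \<inter> Suc ` ?B \<subseteq> Suc ` coinc 2 {c} u"
    proof clarify
      fix a b assume "a \<in> ?A" "b \<in> ?B" "a - 1 = Suc b"
      moreover from this have "a = b + 2" by simp
      ultimately have "b \<in> coinc 2 {c} u" by (simp add: coinc_def)
      then show "a - 1 \<in> Suc ` coinc 2 {c} u" using \<open>a - 1 = Suc b\<close> by simp
    qed
    then have "card ((\<lambda>a. a - 1) ` ?A \<inter> Suc ` ?B) \<le> card (Suc ` coinc 2 {c} u)" by (intro card_mono) auto
    also have "\<dots> = card (coinc 2 {c} u)" by (rule card_image) simp
    finally show ?thesis using u(5) by linarith
  qed
  moreover have "card ((\<lambda>a. a - 1) ` ?A) + card (Suc ` ?B) 
     = card ((\<lambda>a. a - 1) ` ?A \<union> Suc ` ?B) + card ((\<lambda>a. a - 1) ` ?A \<inter> Suc ` ?B)"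
    by (rule card_Un_Int) auto
  moreover have "excess - 1 \<le> card ?A" "excess - 1 \<le> card ?B"
    using card_newidx[OF u(1), of "{c}"] card_lastidx[OF u(1), of "{c}"] by simp_all
  ultimately show ?thesis by linarith
qed

text \<open>\<open>t\<close> is the size of a set of ends and \<open>M\<close> the sum of their
  numbers of missed colours. The upper bound on \<open>M\<close> is a quadratic in \<open>t\<close>
  with its maximum at \<open>t = 5 * l / 7 + 3 / 2\<close>. Its leading term
  \<open>25 / 98 * l^2\<close> there is below the \<open>16 / 49 * l^2\<close> of the lower
  bound.\<close>

lemma generic_case_arith:
  fixes l t M :: real
  assumes "28 / 3 \<le> l" "(9 * l / 7 + 2) * t \<le> (t * (l + 3) - M) + t * l - t * (t - 1) / 2"
    and "(2 * excess - 3) * (2 * excess - 4) \<le> M" "l = real L"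
  shows False
proof -
  have "M \<le> t * (5 * l / 7 + 3 / 2) - t^2 / 2" using assms(2) by (simp add: field_simps power2_eq_square)
  also have "\<dots> \<le> (5 * l / 7 + 3 / 2)^2 / 2"
    using zero_le_power2[of "t - (5 * l / 7 + 3 / 2)"] by (simp add: power2_diff field_simps)
  finally have "M \<le> (5 * l / 7 + 3 / 2)^2 / 2" .
  moreover have e: "2 * excess - 3 = 4 * l / 7 + 1" "2 * excess - 4 = 4 * l / 7" by (simp_all add: excess_def assms(4))
  ultimately have "(4 * l / 7 + 1) * (4 * l / 7) \<le> (5 * l / 7 + 3 / 2)^2 / 2"
    using assms(3) unfolding e by linarith
  then have "l * (l - 7) \<le> 63 / 4" by (simp add: power2_eq_square field_simps)
  moreover have "28 / 3 * (28 / 3 - 7) \<le> l * (l - 7)" using assms(1) by (intro mult_mono) auto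
  ultimately show False by simp
qed

text \<open>A new-colour neighbour at position \<open>L - 1\<close> closes a rainbow cycle through
  all vertices but the last. Without such cycles coincidences are rare, so rotations at both ends
  give nearly disjoint sets of removed colours and of ends, almost \<open>2 * excess\<close> of
  each.\<close>

lemma exists_pendant_cycle:
  assumes xs: "lpath xs"
  shows "\<exists>ys. lpath ys \<and> L - 1 \<in> newidx {} ys"
proof (rule ccontr)
  assume "\<not> ?thesis"
  then have no: "\<And>ys. lpath ys \<Longrightarrow> L - 1 \<notin> newidx {} ys" by blast
  have Ll: "28 / 3 \<le> real L" by (rule L_large[OF xs])
  have "real (card ({} :: 'c set)) < excess" by (simp add: excess_def)
  then obtain w where w: "lpath w" "set w = set xs" "card (coinc 1 {} w) \<le> 3"
    using few_coincidences[OF xs _ no, of "{}" 1 "{}"] by fastforce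
  define V C where "V = set w" and "C = set (ecols w)"
  define A where "A = newidx {} w" 
  define B where "B = lastidx {} w"
  define f where "f i = ecol (w ! (i - 1)) (w ! i)" for i
  \<comment> \<open>\<open>R\<close> consists of the colours that a single rotation of
    \<open>w\<close> removes, and \<open>S c\<close> of ends of paths missing \<open>c\<close>. The
    3 allows one rotation that removes \<open>c\<close> and two more from
    \<open>card_missing_ends\<close>.\<close>
  define R where "R = f ` (A \<union> Suc ` B)"
  define S where "S c = {v. \<exists>ys. lpath ys \<and> set ys = V \<and> hd ys = v \<and> c \<notin> set (ecols ys)
     \<and> card (set (ecols ys) - C) \<le> 3}" for c
  define T where "T = (\<Union>c\<in>R. S c)"
  define M where "M v = {c \<in> C. \<exists>ys. lpath ys \<and> set ys = V \<and> hd ys = v \<and> c \<notin> set (ecols ys)}" for v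
  have SV: "S c \<subseteq> V" for c using lpath_nonempty by (auto simp: S_def)
  have TV: "T \<subseteq> V" using SV by (auto simp: T_def)
  have finV: "finite V" "finite C" by (auto simp: V_def C_def)
  have finS: "finite (S c)" for c using SV finV finite_subset by blast
  have finT: "finite T" using TV finV finite_subset by blast
  have AB: "A \<union> Suc ` B \<subseteq> {0<..L}" by (auto simp: A_def B_def newidx_def lastidx_def)
  have finR: "finite R" by (auto simp: R_def A_def B_def)
  have RC: "R \<subseteq> C" using rot_lpath(5)[OF w(1)] rotr_lpath(6)[OF w(1)] by (auto simp: R_def C_def f_def A_def B_def)
  have cardR: "2 * excess - 3 \<le> card R"
  proof -
    have "card R = card (A \<union> Suc ` B)"
      unfolding R_def f_def using removed_color_inj[OF w(1)] AB by (intro card_image) (rule inj_on_subset)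
    moreover have "card A + card (Suc ` B) = card (A \<union> Suc ` B) + card (A \<inter> Suc ` B)"
      by (rule card_Un_Int) (auto simp: A_def B_def)
    moreover have "card (Suc ` B) = card B" by (rule card_image) simp
    moreover have "A \<inter> Suc ` B \<subseteq> Suc ` coinc 1 {} w" by (auto simp: coinc_def A_def B_def)
    then have "card (A \<inter> Suc ` B) \<le> card (Suc ` coinc 1 {} w)" by (intro card_mono) auto
    then have "card (A \<inter> Suc ` B) \<le> 3" using w(3) card_image[of Suc "coinc 1 {} w"] by simp
    ultimately show ?thesis 
      using card_newidx[OF w(1), of "{}"] card_lastidx[OF w(1), of "{}"] by (simp add: A_def B_def)
  qed
  have cardS: "2 * excess - 4 \<le> card (S c)" if c: "c \<in> R" for c
  proof -
    obtain i where i: "i \<in> A \<union> Suc ` B" "c = f i" using c by (auto simp: R_def)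
    obtain u where u: "lpath u" "set u = V" "c \<notin> set (ecols u)" "card (set (ecols u) - C) \<le> 1"
      using missing_path_rot[OF w(1), of i C] i by (auto simp: f_def A_def B_def V_def C_def)
    show ?thesis using card_missing_ends[OF u(1,3) no u(4)] u(2) by (simp add: S_def)
  qed
  \<comment> \<open>\<open>outdeg_le\<close> speaks of colours of the path \<open>ys\<close> itself,
    which lacks at most 3 of the colours in \<open>C\<close>; this is the loss of 3.\<close>
  have out: "outdeg V v + card (M v) \<le> L + 3" if v: "v \<in> T" for v
  proof -
    obtain ys where ys: "lpath ys" "set ys = V" "hd ys = v" "card (set (ecols ys) - C) \<le> 3"
      using v unfolding T_def S_def by blast
    have 1: "outdeg V v + card (M v \<inter> set (ecols ys)) \<le> L"
      using outdeg_le[OF ys(1), of "M v \<inter> set (ecols ys)"] ys by (auto simp: M_def)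
    have cc: "card C = L" "card (set (ecols ys)) = L" using w(1) ys(1) by (auto simp: C_def lpath_def card_ecols)
    have "card (C - set (ecols ys)) = card (set (ecols ys) - C)"
      using cc finV by (simp add: card_Diff_subset_Int Int_commute)
    moreover have "card (M v) \<le> card (M v \<inter> set (ecols ys)) + card (C - set (ecols ys))"
      using finV by (intro order_trans[OF card_mono card_Un_le]) (auto simp: M_def)
    ultimately show ?thesis using 1 ys(4) by linarith
  qed
  \<comment> \<open>Double counting of the pairs of a colour \<open>c\<close> in \<open>R\<close>
    and an end \<open>v\<close> in \<open>S c\<close>.\<close>
  have "(2 * excess - 3) * (2 * excess - 4) \<le> real (card R) * (2 * excess - 4)"
    using cardR Ll by (intro mult_right_mono) (auto simp: excess_def)
  also have "\<dots> \<le> (\<Sum>c\<in>R. real (card (S c)))" using sum_mono[of R "\<lambda>_. 2 * excess - 4", OF cardS] by simp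
  also have "\<dots> = real (\<Sum>c\<in>R. card {v \<in> T. v \<in> S c})"
    unfolding of_nat_sum by (intro sum.cong refl arg_cong[where f=real] arg_cong[where f=card]) (auto simp: T_def)
  also have "(\<Sum>c\<in>R. card {v \<in> T. v \<in> S c}) = (\<Sum>v\<in>T. card {c \<in> R. v \<in> S c})"
    using sum.swap_restrict[OF finR finT, of "\<lambda>_ _. 1::nat" "\<lambda>c v. v \<in> S c"] by simp
  also have "real \<dots> \<le> real (\<Sum>v\<in>T. card (M v))"
    unfolding of_nat_le_iff
    by (intro sum_mono card_mono) (use RC finV in \<open>auto simp: M_def S_def\<close>)
  finally have low: "(2 * excess - 3) * (2 * excess - 4) \<le> (\<Sum>v\<in>T. real (card (M v)))" by simp
  have "T \<noteq> {}"
  proof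
    assume "T = {}"
    then have "(2 * excess - 3) * (2 * excess - 4) \<le> 0" using low by simp
    moreover have "0 < (2 * excess - 3) * (2 * excess - 4)" using Ll by (intro mult_pos_pos) (auto simp: excess_def)
    ultimately show False by simp
  qed
  then have "(9 * real L / 7 + 2) * card T \<le> (\<Sum>v\<in>T. real (outdeg V v)) + card T * L - card T * (real (card T) - 1) / 2"
    using touching_main[OF _ _ TV] lpath_sub[OF w(1)] lpath_card[OF w(1)] by (simp add: V_def)
  moreover have "(\<Sum>v\<in>T. real (outdeg V v)) \<le> (\<Sum>v\<in>T. real L + 3 - card (M v))"
    by (intro sum_mono) (use out in fastforce)
  then have "(\<Sum>v\<in>T. real (outdeg V v)) \<le> card T * (real L + 3) - (\<Sum>v\<in>T. real (card (M v)))"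
    by (simp add: sum_subtractf)
  ultimately show False using generic_case_arith[OF Ll _ low refl, of "card T"] by simp
qed

subsection \<open>Rainbow cycles with a pendant vertex\<close>

text \<open>A rainbow cycle with \<open>L\<close> edges, cut open into a list. By
  \<open>rcycle_swap\<close> the cut may be moved freely.\<close>

definition rcycle :: "'a list \<Rightarrow> bool" where
  "rcycle zs \<longleftrightarrow> rpath zs \<and> length zs = L \<and> adj (last zs) (hd zs) \<and> ecol (last zs) (hd zs) \<notin> set (ecols zs)"

definition ccols :: "'a list \<Rightarrow> 'c set" where
  "ccols zs = insert (ecol (last zs) (hd zs)) (set (ecols zs))"

definition pnbrs :: "'a \<Rightarrow> 'a list \<Rightarrow> 'a set" where
  "pnbrs u zs = {z. adj u z \<and> ecol u z \<notin> ccols zs}"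

lemma ccols_swap: "p \<noteq> [] \<Longrightarrow> q \<noteq> [] \<Longrightarrow> ccols (q @ p) = ccols (p @ q)"
  by (auto simp: ccols_def ecols_append)

lemma pnbrs_swap: "p \<noteq> [] \<Longrightarrow> q \<noteq> [] \<Longrightarrow> pnbrs u (q @ p) = pnbrs u (p @ q)"
  by (simp add: pnbrs_def ccols_swap)

lemma rcycle_swap:
  assumes "rcycle (p @ q)" "p \<noteq> []" "q \<noteq> []"
  shows "rcycle (q @ p)"
  using assms by (auto simp: rcycle_def rpath_append ecols_append)

lemma card_ccols: "rcycle zs \<Longrightarrow> card (ccols zs) = L"
  by (cases zs) (auto simp: rcycle_def ccols_def card_ecols rpath_def)

lemma pendant_lpath:
  assumes "rcycle zs" "u \<notin> set zs" "last zs \<in> pnbrs u zs"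
  shows "lpath (zs @ [u])"
proof -
  have "zs \<noteq> []" using assms by (auto simp: rcycle_def rpath_def)
  then show ?thesis using assms 
    by (auto simp: lpath_def rcycle_def rpath_snoc pnbrs_def ccols_def adj_commute ecol_commute)
qed

text \<open>\<open>zs @ [u]\<close> is a longest path, so every colour leaving it at
  \<open>u\<close> lies on it. The only such colour off the cycle is that of the edge from
  \<open>u\<close> to \<open>last zs\<close>.\<close>

lemma pnbrs_sub:
  assumes zs: "rcycle zs" "u \<notin> set zs" "last zs \<in> pnbrs u zs"
  shows "pnbrs u zs \<subseteq> set zs"
proof
  fix w assume w: "w \<in> pnbrs u zs"
  have ne: "zs \<noteq> []" using zs by (auto simp: rcycle_def rpath_def)
  show "w \<in> set zs"
  proof (rule ccontr)
    assume "w \<notin> set zs"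
    moreover have "w \<noteq> u" using w adj_neq[of u w] by (auto simp: pnbrs_def)
    moreover have "lpath (rev (zs @ [u]))" using pendant_lpath[OF zs] by (simp only: lpath_rev)
    ultimately have "ecol u w \<in> set (ecols (rev (zs @ [u])))"
      using outside_color[of "rev (zs @ [u])" w] w by (auto simp: pnbrs_def)
    then have "ecol u w \<in> set (ecols (zs @ [u]))" by (simp only: ecols_rev set_rev)
    then have "ecol u w = ecol u (last zs)" 
      using w ne by (auto simp: ecols_append pnbrs_def ccols_def ecol_commute)
    then have "w = last zs" using w zs(3) by (auto simp: pnbrs_def intro: ecol_inj)
    then show False using \<open>w \<notin> set zs\<close> ne by simp
  qed
qed

lemma card_pnbrs:
  assumes "rcycle zs" "u \<in> U"
  shows "excess \<le> card (pnbrs u zs)"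
  using card_new_nbrs[OF assms(2), of "ccols zs"] card_ccols[OF assms(1)]
  by (simp add: pnbrs_def ccols_def)

text \<open>The first and last vertices are consecutive on the cycle; inserting \<open>u\<close>
  between them would give a rainbow cycle on all \<open>L + 1\<close> vertices.\<close>

lemma pnbrs_not_consecutive:
  assumes zs: "rcycle zs" "u \<notin> set zs" "last zs \<in> pnbrs u zs"
  shows "hd zs \<notin> pnbrs u zs"
proof
  assume h: "hd zs \<in> pnbrs u zs"
  have p: "lpath (zs @ [u])" by (rule pendant_lpath[OF zs])
  have l: "length zs = L" "zs \<noteq> []" using zs by (auto simp: rcycle_def rpath_def)
  have "adj (last zs) (hd zs)" using zs by (simp add: rcycle_def)
  then have "hd zs \<noteq> last zs" using adj_neq by metis
  then have "ecol u (hd zs) \<noteq> ecol u (last zs)" using h zs(3) ecol_inj by (auto simp: pnbrs_def)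
  moreover have "(zs @ [u]) ! L = u" "0 < L" using l by (auto simp: nth_append)
  ultimately have "L \<in> newidx {} (zs @ [u])"
    using h l(2) by (auto simp: newidx_def pnbrs_def ecols_append ccols_def adj_commute ecol_commute)
  then show False using no_hamiltonian_rainbow_cycle[OF p] by blast
qed

text \<open>Follow \<open>p\<close>, step over \<open>u\<close> to the end of \<open>q\<close> and
  run through \<open>q\<close> backwards. The two cycle edges between \<open>p\<close> and
  \<open>q\<close> are dropped, and the two edges at \<open>u\<close> have new colours. The ends are
  \<open>hd p\<close> and \<open>hd q\<close>.\<close>

lemma insert_pendant:
  assumes c: "rcycle (p @ q)" and u: "u \<notin> set (p @ q)" and ne: "p \<noteq> []" "q \<noteq> []"
    and N: "last p \<in> pnbrs u (p @ q)" "last q \<in> pnbrs u (p @ q)"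
  shows "lpath (p @ u # rev q)" "set (ecols (p @ u # rev q)) = set (ecols p) \<union> set (ecols q) \<union> {ecol u (last p), ecol u (last q)}"
    "ecol (last p) (hd q) \<notin> set (ecols (p @ u # rev q))"
proof -
  have cc: "ccols (p @ q) = insert (ecol (last q) (hd p)) (insert (ecol (last p) (hd q)) (set (ecols p) \<union> set (ecols q)))"
    using ne by (auto simp: ccols_def ecols_append)
  have r: "rpath (p @ q)" "length (p @ q) = L" using c by (auto simp: rcycle_def)
  note rr = r(1)[unfolded rpath_append[OF ne]]
  have "last p \<noteq> last q" using rr ne by (metis disjoint_iff last_in_set)
  then have d: "ecol u (last p) \<noteq> ecol u (last q)" using N ecol_inj by (auto simp: pnbrs_def)
  show e: "set (ecols (p @ u # rev q)) = set (ecols p) \<union> set (ecols q) \<union> {ecol u (last p), ecol u (last q)}"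
    using ne by (auto simp: ecols_append ecols_Cons hd_rev ecols_rev ecol_commute)
  show "ecol (last p) (hd q) \<notin> set (ecols (p @ u # rev q))"
    using rr N unfolding e by (auto simp: pnbrs_def cc)
  have "rpath (u # rev q)"
    using rr u ne N by (subst rpath_Cons) (auto simp: hd_rev ecols_rev pnbrs_def cc)
  then have "rpath (p @ u # rev q)"
    using rr u ne N d by (subst rpath_append) (auto simp: hd_rev ecols_rev ecols_Cons pnbrs_def cc adj_commute ecol_commute)
  then show "lpath (p @ u # rev q)" using r(2) by (simp add: lpath_def)
qed

text \<open>The exceptional positions: \<open>u\<close> reaches a vertex \<open>z\<close> of
  \<open>q\<close>, and \<open>hd q\<close> reaches the successor of \<open>z\<close>, in the same
  colour, so these two edges cannot lie on a common rainbow cycle.\<close>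

definition clash :: "'a \<Rightarrow> 'a list \<Rightarrow> 'a list \<Rightarrow> nat set" where
  "clash u p q = {i. length p \<le> i \<and> Suc i < L \<and> (p @ q) ! i \<in> pnbrs u (p @ q) 
     \<and> adj (hd q) ((p @ q) ! Suc i) \<and> ecol (hd q) ((p @ q) ! Suc i) = ecol u ((p @ q) ! i)}"

lemma finite_clash [simp]: "finite (clash u p q)"
  by (rule finite_subset[of _ "{..L}"]) (auto simp: clash_def)

text \<open>From \<open>hd p\<close> one avoids every cycle edge that follows a neighbour of \<open>u\<close>, by inserting \<open>u\<close> there; a
  second rotation, at the end \<open>hd q\<close>, avoids further edges. As \<open>p\<close> meets the neighbours of \<open>u\<close> only in its
  last vertex, the two families overlap only in clashes, since any other overlap closes a rainbow cycle.\<close>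

lemma outdeg_block_start:
  assumes c: "rcycle (p @ q)" and u: "u \<in> U" "u \<notin> set (p @ q)" and ne: "p \<noteq> []" "q \<noteq> []"
    and N: "last p \<in> pnbrs u (p @ q)" "last q \<in> pnbrs u (p @ q)"
    and first: "\<And>z. z \<in> set p \<Longrightarrow> z \<in> pnbrs u (p @ q) \<Longrightarrow> z = last p"
  shows "outdeg (insert u (set (p @ q))) (hd p) + card (pnbrs u (p @ q)) + excess \<le> L + 3 + card (clash u p q)"
proof -
  define w where "w = p @ q"
  define K where "K = ccols w"
  define NN where "NN = pnbrs u w"
  define s where "s = hd q"
  define f where "f i = ecol (w ! i) (w ! Suc i)" for i
  \<comment> \<open>Neighbours of \<open>u\<close> whose following edge lies on the list
    \<open>w\<close>. This leaves out \<open>last w\<close>, hence the \<open>Suc\<close> in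
    \<open>cardJ\<close>.\<close>
  define J where "J = {i. Suc i < L \<and> w ! i \<in> NN}"
  define W where "W = p @ u # rev q"
  define g where "g b = ecol (W ! b) (W ! Suc b)" for b
  \<comment> \<open>Forbidding all of \<open>K\<close> also excludes the colours of the two cycle
    edges that \<open>W\<close> drops, so the chords used are new to the whole cycle.\<close>
  define B where "B = lastidx K W"
  have cw: "rcycle w" and uw: "u \<notin> set w" using c u by (auto simp: w_def)
  have lw: "length w = L" "w \<noteq> []" and rw: "rpath w" using c ne by (auto simp: w_def rcycle_def)
  have dw: "distinct w" using rw by (simp add: rpath_def)
  have lq: "last w = last q" "hd w = hd p" using ne by (auto simp: w_def)
  have lastN: "last w \<in> NN" using N lq by (simp add: NN_def w_def)
  have lxs: "lpath (w @ [u])" using pendant_lpath[OF cw uw] lastN by (simp add: NN_def)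
  have exs: "set (ecols w) \<subseteq> set (ecols (w @ [u]))" using lw by (auto simp: ecols_append)
  note IW = insert_pendant[OF c u(2) ne N, folded W_def]
  have lW: "length W = Suc L" "last W = s" "hd W = hd w" "set W = insert u (set w)"
    using lw ne by (auto simp: W_def s_def w_def last_rev)
  have rp: "rpath p" "rpath q" "ecol (last p) (hd q) \<notin> set (ecols p)" "ecol (last p) (hd q) \<notin> set (ecols q)"
    using rw ne by (auto simp: w_def rpath_append)
  have ecw: "set (ecols w) = set (ecols p) \<union> set (ecols q) \<union> {ecol (last p) (hd q)}"
    using ne by (auto simp: w_def ecols_append)
  have missJ: "\<exists>ys. lpath ys \<and> set ys = set (w @ [u]) \<and> hd ys = hd (w @ [u]) \<and> f i \<notin> set (ecols ys)" if i: "i \<in> J" for i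
  proof -
    let ?p = "take (Suc i) w" and ?q = "drop (Suc i) w"
    have ne': "?p \<noteq> []" "?q \<noteq> []" using i lw by (auto simp: J_def)
    have lp: "last ?p = w ! i" "hd ?q = w ! Suc i" using i lw by (auto simp: J_def take_Suc_conv_app_nth hd_drop_conv_nth)
    have "last ?q = last w" using i lw by (auto simp: J_def)
    then have N': "last ?p \<in> pnbrs u (?p @ ?q)" "last ?q \<in> pnbrs u (?p @ ?q)" 
      using i lp lastN by (auto simp: J_def NN_def)
    have c': "rcycle (?p @ ?q)" "u \<notin> set (?p @ ?q)" using cw uw by (auto simp del: set_append)
    have sw: "set ?p \<union> set ?q = set w" by (metis append_take_drop_id set_append)
    show ?thesis
      using insert_pendant[OF c' ne' N'] lp ne' lw sw 
      by (intro exI[of _ "?p @ u # rev ?q"]) (auto simp: f_def)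
  qed
  have Bprop: "b < L" "adj s (W ! b)" "ecol s (W ! b) \<notin> set (ecols W)" "ecol s (W ! b) \<notin> K" if "b \<in> B" for b
    using that lW by (auto simp: B_def lastidx_def)
  have Wp: "W ! (length p - 1) = last p" "W ! length p = u" "W ! Suc (length p) = last q"
    using ne by (auto simp: W_def nth_append last_conv_nth rev_nth)
  \<comment> \<open>These rotations remove neither edge at \<open>u\<close>, so each removed colour
    is a cycle colour. Indeed \<open>hd q\<close> follows \<open>last p\<close> on the cycle: it is
    no new-colour neighbour of \<open>u\<close>, and its edge to \<open>last p\<close> has a cycle
    colour.\<close>
  have Bu: "b \<noteq> length p" "b \<noteq> length p - 1" if b: "b \<in> B" for b
  proof -
    have "s \<notin> NN"
    proof -
      have "rcycle (q @ p)" "u \<notin> set (q @ p)" "last (q @ p) \<in> pnbrs u (q @ p)"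
        using rcycle_swap[OF c ne] u ne N pnbrs_swap[OF ne] by auto
      then have "hd (q @ p) \<notin> pnbrs u (q @ p)" by (rule pnbrs_not_consecutive)
      then show ?thesis using ne pnbrs_swap[OF ne] by (simp add: NN_def w_def s_def)
    qed
    then show "b \<noteq> length p" using Bprop[OF b] Wp by (auto simp: NN_def pnbrs_def K_def adj_commute ecol_commute)
    have "ecol s (last p) \<in> K" by (simp add: K_def ccols_def ecw s_def ecol_commute)
    then show "b \<noteq> length p - 1" using Bprop[OF b] Wp by auto
  qed
  have gB: "g b \<in> set (ecols p) \<union> set (ecols q)" if b: "b \<in> B" for b
  proof -
    have rW: "rpath W" using IW(1) by (simp add: lpath_def)
    have len: "Suc (length p) < length W" using lW(1) lw(1) ne by (cases q) (auto simp: w_def)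
    have "g b \<noteq> ecol u (last p)"
      using nth_ecol_inj[OF rW, of b "length p - 1"] Bu[OF b] Bprop(1)[OF b] lW Wp len ne
      by (auto simp: g_def ecol_commute)
    moreover have "g b \<noteq> ecol u (last q)"
      using nth_ecol_inj[OF rW, of b "length p"] Bu[OF b] Bprop(1)[OF b] lW Wp len
      by (auto simp: g_def)
    moreover have "g b \<in> set (ecols W)" using ecol_nth_mem[of b W] Bprop(1)[OF b] lW by (simp add: g_def)
    ultimately show ?thesis using IW(2) by auto
  qed
  have missB: "\<exists>ys. lpath ys \<and> set ys = set (w @ [u]) \<and> hd ys = hd (w @ [u]) \<and> g b \<notin> set (ecols ys)" if b: "b \<in> B" for b
    using rotr_lpath[OF IW(1), of b K] b lW lw
    by (intro exI[of _ "rotr b W"]) (auto simp: B_def g_def)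
  have fJ: "f i \<in> set (ecols w)" if "i \<in> J" for i
    using ecol_nth_mem[of i w] that lw by (simp add: J_def f_def)
  have finJ: "finite J" by (rule finite_subset[of _ "{..L}"]) (auto simp: J_def)
  have finB: "finite B" by (simp add: B_def)
  have "outdeg (set (w @ [u])) (hd (w @ [u])) + card (f ` J \<union> g ` B) \<le> L"
  proof (rule outdeg_le[OF lxs])
    show "f ` J \<union> g ` B \<subseteq> set (ecols (w @ [u]))" using fJ gB exs ecw by blast
  qed (use missJ missB in blast)
  then have main: "outdeg (insert u (set w)) (hd p) + card (f ` J \<union> g ` B) \<le> L"
    using lw lq by (simp add: insert_commute)
  have cardJ: "Suc (card (f ` J)) = card NN"
  proof -
    have inj: "inj_on f J"
      by (rule inj_onI) (use nth_ecol_inj[OF rw] lw in \<open>auto simp: J_def f_def\<close>)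
    have "NN \<subseteq> set w" using pnbrs_sub[OF cw uw] lastN by (simp add: NN_def)
    have L0: "last w = w ! (L - 1)" "0 < L" using lw by (auto simp: last_conv_nth simp flip: lw(1))
    have "NN = insert (last w) ((!) w ` J)"
    proof
      show "NN \<subseteq> insert (last w) ((!) w ` J)"
      proof
        fix z assume z: "z \<in> NN"
        then obtain i where i: "i < L" "z = w ! i" using \<open>NN \<subseteq> set w\<close> lw by (metis in_set_conv_nth subsetD)
        show "z \<in> insert (last w) ((!) w ` J)"
          using i z L0 by (cases "i = L - 1") (auto simp: J_def)
      qed
      show "insert (last w) ((!) w ` J) \<subseteq> NN" using lastN by (auto simp: J_def)
    qed
    moreover have "last w \<notin> (!) w ` J"
      using L0 lw dw by (auto simp: J_def nth_eq_iff_index_eq)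
    moreover have "card ((!) w ` J) = card J"
      by (rule card_image, rule inj_onI) (use dw lw in \<open>auto simp: J_def nth_eq_iff_index_eq\<close>)
    ultimately show ?thesis using finJ card_image[OF inj] by simp
  qed
  \<comment> \<open>The \<open>L\<close> cycle colours and the two colours at \<open>u\<close> are
    forbidden at \<open>hd q\<close>; the far ends of the remaining edges lie on
    \<open>W\<close>.\<close>
  have cardB: "excess - 2 \<le> card (g ` B)"
  proof -
    let ?C = "K \<union> {ecol u (last p), ecol u (last q)}"
    let ?D = "{y. adj s y \<and> ecol s y \<notin> ?C}"
    have sU: "s \<in> U" using ne rw by (auto simp: s_def w_def rpath_def)
    have fK: "finite K" by (simp add: K_def ccols_def)
    have "card ?C \<le> L + 2"
      using card_Un_le[of K "{ecol u (last p), ecol u (last q)}"] card_ccols[OF cw]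
        card_insert_le_m1[of 2 "{ecol u (last q)}" "ecol u (last p)"] by (simp add: K_def)
    moreover have "real L + excess - card ?C \<le> card ?D" using card_new_nbrs[OF sU, of ?C] fK by simp
    moreover have "?D \<subseteq> (!) W ` B"
    proof
      fix y assume y: "y \<in> ?D"
      have eW: "set (ecols W) \<subseteq> ?C" using IW(2) by (auto simp: K_def ccols_def ecw)
      have nW: "W \<noteq> []" using lW by auto
      have "y \<in> set W"
      proof (rule ccontr)
        assume "y \<notin> set W"
        then have "ecol s y \<in> set (ecols (rev W))" 
          using outside_color[of "rev W" y] IW(1) y lW nW by (simp add: hd_rev)
        then show False using y eW by (auto simp: ecols_rev)
      qed
      then obtain b where b: "b < Suc L" "y = W ! b" using lW by (metis in_set_conv_nth)
      have "b \<noteq> L" using y b lW nW adj_neq[of s y] by (auto simp: last_conv_nth)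
      then have "b \<in> B" using b y eW lW by (auto simp: B_def lastidx_def)
      then show "y \<in> (!) W ` B" using b by auto
    qed
    then have "card ?D \<le> card B" by (meson surj_card_le finB)
    moreover have "card (g ` B) = card B"
      by (rule card_image, rule inj_onI) 
        (use nth_ecol_inj[of W] IW(1) lW Bprop(1) in \<open>auto simp: g_def lpath_def\<close>)
    ultimately show ?thesis by linarith
  qed
  have "f ` J \<inter> g ` B \<subseteq> f ` clash u p q"
  proof clarify
    fix i b assume i: "i \<in> J" and b: "b \<in> B" and e: "f i = g b"
    have "f i \<noteq> ecol (last p) (hd q)" using gB[OF b] e rp by auto
    \<comment> \<open>Within \<open>p\<close> only \<open>last p\<close> is a new-colour neighbour
      of \<open>u\<close>, and the cycle edge after it is not on \<open>W\<close>.\<close>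
    have "length p \<le> i"
    proof (rule ccontr)
      assume "\<not> length p \<le> i"
      then have ip: "i < length p" by simp
      then have "w ! i = last p" using first[of "w ! i"] i by (auto simp: w_def nth_append J_def NN_def)
      also have "last p = w ! (length p - 1)" using ne by (simp add: w_def nth_append last_conv_nth)
      finally have "i = length p - 1" using dw lw ip i by (simp add: nth_eq_iff_index_eq J_def w_def)
      then have "f i = ecol (last p) (hd q)" using ne by (simp add: f_def w_def nth_append last_conv_nth hd_conv_nth)
      then show False using \<open>f i \<noteq> ecol (last p) (hd q)\<close> by simp
    qed
    define k where "k = i - length p"
    have k: "Suc k < length q" "i = length p + k" using i \<open>length p \<le> i\<close> lw by (auto simp: J_def k_def w_def)
    define r z z' t where "r = take k q" and "z = q ! k" and "z' = q ! Suc k" and "t = drop (Suc (Suc k)) q"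
    have q: "q = r @ z # z' # t" using k by (simp add: r_def z_def z'_def t_def Cons_nth_drop_Suc)
    have wz: "w ! i = z" "w ! Suc i = z'" using k by (auto simp: w_def z_def z'_def nth_append)
    \<comment> \<open>\<open>W\<close> runs through \<open>q\<close> backwards and meets
      \<open>z'\<close> just before \<open>z\<close>, so \<open>b\<close> is the position of
      \<open>z'\<close>.\<close>
    have "W = (p @ u # rev t) @ z' # z # rev r" by (simp add: W_def q)
    then have "W ! (length (p @ u # rev t)) = z'" "W ! Suc (length (p @ u # rev t)) = z" 
      "Suc (length (p @ u # rev t)) < length W" by (simp_all only: nth_append_length nth_append) auto
    moreover have "g b = ecol z z'" using e wz by (simp add: f_def)
    ultimately have "b = length (p @ u # rev t)"
      using nth_ecol_inj[of W b "length (p @ u # rev t)"] IW(1) Bprop(1)[OF b] lW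
      by (auto simp: lpath_def g_def ecol_commute)
    then have Wb: "W ! b = z'" using \<open>W ! (length (p @ u # rev t)) = z'\<close> by simp
    have zN: "z \<in> NN" using i wz by (simp add: J_def)
    have "ecol s z' = ecol u z"
    proof (rule ccontr)
      assume neq: "ecol s z' \<noteq> ecol u z"
      \<comment> \<open>Inserting \<open>u\<close> after \<open>z\<close> instead gives a path from
        \<open>hd q\<close> to \<open>z'\<close>. The chord between these ends closes it to a
        rainbow cycle unless its colour is that of the edge from \<open>u\<close> to
        \<open>z\<close>.\<close>
      let ?p = "r @ [z]" and ?q = "z' # t @ p"
      have pq: "?p @ ?q = q @ p" by (simp add: q)
      have c': "rcycle (?p @ ?q)" "u \<notin> set (?p @ ?q)" using rcycle_swap[OF c ne] u unfolding pq by auto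
      have N': "last ?p \<in> pnbrs u (?p @ ?q)" "last ?q \<in> pnbrs u (?p @ ?q)"
        using zN N ne unfolding pq pnbrs_swap[OF ne] by (auto simp: NN_def w_def)
      note I = insert_pendant[OF c' _ _ N']
      let ?W = "?p @ u # rev ?q"
      have hW: "hd ?W = s" by (simp add: s_def q hd_append)
      have "length ?W = Suc L" using I(1) ne by (simp add: lpath_def)
      then have "?W ! L = last ?W" by (subst last_conv_nth) auto
      then have lastW: "?W ! L = z'" by simp
      have "set (ecols ?p) \<union> set (ecols ?q) \<subseteq> K"
      proof -
        have "set (ecols ?p) \<union> set (ecols ?q) \<subseteq> set (ecols (?p @ ?q))" by (subst ecols_append) auto
        also have "\<dots> \<subseteq> ccols (q @ p)" unfolding pq ccols_def by auto
        also have "\<dots> = K" by (simp add: K_def w_def ccols_swap[OF ne])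
        finally show ?thesis .
      qed
      then have "set (ecols ?W) \<subseteq> K \<union> {ecol u z, ecol u (last p)}" using I(2) ne by auto
      moreover have "ecol s z' \<noteq> ecol u (last p)" using Bprop(3)[OF b] Wb IW(2) by auto
      ultimately have "ecol s z' \<notin> set (ecols ?W)" using Bprop(4)[OF b] Wb neq by auto
      moreover have "0 < L" using lw by (auto simp flip: lw(1))
      moreover have "adj s z'" using Bprop(2)[OF b] Wb by simp
      ultimately have "L \<in> newidx {} ?W"
        unfolding newidx_def hW Un_empty_right mem_Collect_eq lastW by blast
      then show False using no_hamiltonian_rainbow_cycle[OF I(1)] by simp
    qed
    then have "i \<in> clash u p q" using i zN wz Bprop(2)[OF b] Wb \<open>length p \<le> i\<close>
      by (auto simp: clash_def J_def NN_def s_def w_def)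
    then show "f i \<in> f ` clash u p q" by blast
  qed
  then have "card (f ` J \<inter> g ` B) \<le> card (f ` clash u p q)" by (intro card_mono) auto
  also have "\<dots> \<le> card (clash u p q)" by (rule card_image_le) simp
  finally have "card (f ` J \<inter> g ` B) \<le> card (clash u p q)" .
  moreover have "card (f ` J) + card (g ` B) = card (f ` J \<union> g ` B) + card (f ` J \<inter> g ` B)"
    by (rule card_Un_Int) (use finJ finB in auto)
  ultimately show ?thesis using main cardJ cardB by (simp add: NN_def w_def)
qed

text \<open>The cycle is cut into blocks, each ending at a new-colour neighbour of \<open>u\<close>.
  \<open>outdeg_block_start\<close> bounds the out-degree of every block start, and there is on
  average at most one clash per block.\<close>

lemma no_pendant_cycle:
  assumes c: "rcycle zs" and u: "u \<in> U" "u \<notin> set zs" and l: "last zs \<in> pnbrs u zs"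
  shows False
proof -
  define N where "N = pnbrs u zs"
  define V where "V = insert u (set zs)"
  define I where "I = {i. i < L \<and> zs ! i \<in> N}"
  \<comment> \<open>One past the previous neighbour of \<open>u\<close>. The default 0 is right for
    the first block because \<open>L - 1\<close> is in \<open>I\<close> and its cyclic successor is
    0.\<close>
  define st where "st i = Max (insert 0 (Suc ` {j \<in> I. j < i}))" for i
  define p where "p i = drop (st i) (take (Suc i) zs)" for i
  define q where "q i = drop (Suc i) zs @ take (st i) zs" for i
  define v where "v i = zs ! st i" for i
  define nx where "nx i = zs ! (Suc i mod L)" for i
  have lz: "length zs = L" "zs \<noteq> []" "distinct zs" "set zs \<subseteq> U" using c by (auto simp: rcycle_def rpath_def)
  have L0: "0 < L" using lz by (auto simp flip: lz(1))
  have finI: "finite I" by (auto simp: I_def)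
  have lxs: "lpath (zs @ [u])" by (rule pendant_lpath[OF c u(2) l])
  have Ll: "28 / 3 \<le> real L" by (rule L_large[OF lxs])
  have lastz: "last zs = zs ! (L - 1)" using lz by (simp add: last_conv_nth)
  have LI: "L - 1 \<in> I" using l L0 lastz by (simp add: I_def N_def)
  have cardI: "card N = card I"
  proof -
    have "N = (!) zs ` I"
      using pnbrs_sub[OF c u(2) l] lz by (fastforce simp: I_def N_def in_set_conv_nth)
    moreover have "inj_on ((!) zs) I" using lz by (auto simp: inj_on_def I_def nth_eq_iff_index_eq)
    ultimately show ?thesis by (simp add: card_image)
  qed
  have xI: "excess \<le> card I" using card_pnbrs[OF c u(1)] cardI by (simp add: N_def)
  have st_le: "st i \<le> i" for i using finI by (auto simp: st_def)
  have st_ge: "Suc j \<le> st i" if "j \<in> I" "j < i" for i j using finI that by (auto simp: st_def intro!: Max_ge)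
  have st_cases: "st i = 0 \<or> (0 < st i \<and> st i - 1 \<in> I)" for i
  proof -
    have "st i \<in> insert 0 (Suc ` {j \<in> I. j < i})" unfolding st_def using finI by (intro Max_in) auto
    then show ?thesis by auto
  qed
  have block: "rcycle (p i @ q i)" "u \<notin> set (p i @ q i)" "p i \<noteq> []" "q i \<noteq> []"
    "pnbrs u (p i @ q i) = N" "last (p i) \<in> N" "last (q i) \<in> N" "set (p i @ q i) = set zs"
    "hd (p i) = v i" "hd (q i) = nx i" "p i @ q i = rotate (st i) zs"
    "\<And>z. z \<in> set (p i) \<Longrightarrow> z \<in> N \<Longrightarrow> z = last (p i)" if i: "i \<in> I" for i
  proof -
    have iL: "i < L" "zs ! i \<in> N" using i by (auto simp: I_def)
    have pq: "p i @ q i = drop (st i) zs @ take (st i) zs"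
    proof -
      have "drop (st i) (take (Suc i) zs @ drop (Suc i) zs) = p i @ drop (Suc i) zs"
        using st_le[of i] iL lz unfolding drop_append by (simp add: p_def)
      then show ?thesis by (simp add: q_def)
    qed
    show rt: "p i @ q i = rotate (st i) zs"
      using st_le[of i] iL lz by (simp add: pq rotate_drop_take)
    have dne: "drop (st i) zs \<noteq> []" using st_le[of i] iL lz by simp
    show pne: "p i \<noteq> []" using st_le[of i] iL lz by (simp add: p_def)
    \<comment> \<open>With only one neighbour of \<open>u\<close>, its block would be the whole
      cycle and \<open>q i\<close> empty; but \<open>card I\<close> is at least
      \<open>excess\<close>, which exceeds 1.\<close>
    have "st i \<noteq> 0" if "i = L - 1"
    proof
      assume "st i = 0"
      then have "j \<notin> I" if "j < i" for j using st_ge[of j i] that by auto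
      moreover have "j \<le> i" if "j \<in> I" for j using that \<open>i = L - 1\<close> by (auto simp: I_def)
      ultimately have "I \<subseteq> {i}" by (metis le_neq_implies_less singletonI subsetI)
      then have "card I \<le> 1" using card_mono[of "{i}" I] by simp
      then show False using xI by (simp add: excess_def)
    qed
    then have "i < L - 1 \<or> 0 < st i" using iL by (cases "i = L - 1") auto
    then show qne: "q i \<noteq> []" using iL lz by (auto simp: q_def)
    have lastp: "last (p i) = zs ! i" using st_le[of i] iL lz
      by (simp add: p_def last_drop take_Suc_conv_app_nth)
    then show "last (p i) \<in> N" using iL by simp
    show "last (q i) \<in> N"
    proof (cases "st i = 0")
      case True
      then have "i < L - 1" using \<open>i < L - 1 \<or> 0 < st i\<close> by simp
      then show ?thesis using True lz l by (simp add: q_def N_def)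
    next
      case False
      then have s: "st i - 1 \<in> I" using st_cases[of i] by simp
      have "take (st i) zs = take (st i - 1) zs @ [zs ! (st i - 1)]"
        using False st_le[of i] iL lz take_Suc_conv_app_nth[of "st i - 1" zs] by simp
      then show ?thesis using s by (simp add: q_def I_def)
    qed
    show hdp: "hd (p i) = v i" using st_le[of i] iL lz by (simp add: p_def v_def hd_drop_conv_nth)
    show "hd (q i) = nx i"
    proof (cases "Suc i < L")
      case True
      then show ?thesis using lz by (simp add: q_def nx_def hd_append hd_drop_conv_nth)
    next
      case False
      then have "Suc i = L" using iL by simp
      moreover from this have "0 < st i" using \<open>i < L - 1 \<or> 0 < st i\<close> by auto
      ultimately show ?thesis using lz by (simp add: q_def nx_def hd_conv_nth)
    qed
    show sq: "set (p i @ q i) = set zs" unfolding rt by simp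
    show "u \<notin> set (p i @ q i)" using u sq by simp
    show "rcycle (p i @ q i)"
      using rcycle_swap[of "take (st i) zs" "drop (st i) zs"] c dne unfolding pq
      by (cases "take (st i) zs = []") auto
    show "pnbrs u (p i @ q i) = N"
      using pnbrs_swap[of "take (st i) zs" "drop (st i) zs" u] dne unfolding pq N_def
      by (cases "take (st i) zs = []") auto
    show "z = last (p i)" if z: "z \<in> set (p i)" "z \<in> N" for z
    proof -
      obtain m where m: "m < length (p i)" "z = p i ! m" using z(1) by (auto simp: in_set_conv_nth)
      have "st i + m < Suc i" "z = zs ! (st i + m)" using m iL lz by (auto simp: p_def)
      moreover from this have "st i + m \<in> I" using z(2) iL by (simp add: I_def)
      ultimately have "st i + m = i" using st_ge[of "st i + m" i] by (cases "st i + m < i") auto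
      then show ?thesis using \<open>z = zs ! (st i + m)\<close> lastp by simp
    qed
  qed
  have nx_inj: "i = i'" if "i < L" "i' < L" "nx i = nx i'" for i i'
  proof -
    have "Suc i mod L = Suc i' mod L"
      using that lz L0 by (simp add: nx_def nth_eq_iff_index_eq)
    then show ?thesis using that by (auto simp: mod_Suc split: if_splits)
  qed
  have sum_clash: "(\<Sum>i\<in>I. card (clash u (p i) (q i))) \<le> card I"
  proof -
    let ?P = "SIGMA i:I. clash u (p i) (q i)"
    \<comment> \<open>The position of the clash on the original cycle. It determines a vertex and a
      colour which by properness determine \<open>nx i\<close>, so each position in \<open>I\<close>
      is hit at most once.\<close>
    let ?h = "\<lambda>(i, k). (k + st i) mod L"
    have P: "i \<in> I \<and> k < L \<and> (k + st i) mod L \<in> I \<and> adj (nx i) (nx ((k + st i) mod L)) 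
      \<and> ecol (nx i) (nx ((k + st i) mod L)) = ecol u (zs ! ((k + st i) mod L))" if "(i, k) \<in> ?P" for i k
    proof -
      have i: "i \<in> I" and k: "Suc k < L" using that by (auto simp: clash_def)
      have "(p i @ q i) ! k = zs ! ((k + st i) mod L)" "(p i @ q i) ! Suc k = nx ((k + st i) mod L)"
        using k lz by (simp_all add: block(11)[OF i] nth_rotate nx_def mod_Suc_eq add.commute)
      then show ?thesis using that i k L0 unfolding clash_def mem_Sigma_iff mem_Collect_eq block(5,10)[OF i] by (auto simp: I_def)
    qed
    have "card ?P \<le> card I"
    proof (rule card_inj_on_le[of ?h])
      show "inj_on ?h ?P"
      proof (rule inj_onI)
        fix a b assume ab: "a \<in> ?P" "b \<in> ?P" "?h a = ?h b"
        obtain i k i' k' where eq: "a = (i, k)" "b = (i', k')" by (cases a, cases b)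
        have m: "(i, k) \<in> ?P" "(i', k') \<in> ?P" and e: "(k + st i) mod L = (k' + st i') mod L"
          using ab unfolding eq by auto
        have "nx i = nx i'"
          using P[OF m(1)] P[OF m(2)] e by (intro ecol_inj'[of _ "nx ((k + st i) mod L)"]) auto
        then have "i = i'" using nx_inj P[OF m(1)] P[OF m(2)] by (auto simp: I_def)
        moreover have "k = k'"
        proof -
          have i: "i \<in> I" using P[OF m(1)] by simp
          have "distinct (rotate (st i) zs)" using lz by simp
          moreover have "rotate (st i) zs ! k = rotate (st i) zs ! k'"
            using e P[OF m(1)] P[OF m(2)] \<open>i = i'\<close> lz by (simp add: nth_rotate add.commute)
          ultimately show ?thesis using P[OF m(1)] P[OF m(2)] lz by (simp add: nth_eq_iff_index_eq)
        qed
        ultimately show "a = b" by (simp add: eq)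
      qed
      show "?h ` ?P \<subseteq> I" using P by auto
    qed (rule finI)
    then show ?thesis using finI by simp
  qed
  have inj_st: "inj_on st I"
  proof (rule inj_onI)
    fix i j assume "i \<in> I" "j \<in> I" "st i = st j"
    then show "i = j" using st_ge[of i j] st_ge[of j i] st_le[of i] st_le[of j] by (cases i j rule: linorder_cases) auto
  qed
  have inj_v: "inj_on v I"
  proof (rule inj_onI)
    fix i j assume ij: "i \<in> I" "j \<in> I" "v i = v j"
    then have "st i = st j" using st_le[of i] st_le[of j] lz by (auto simp: v_def I_def nth_eq_iff_index_eq)
    then show "i = j" using inj_st ij by (auto dest: inj_onD)
  qed
  have VU: "V \<subseteq> U" "card V = Suc L" using lz u by (auto simp: V_def distinct_card)
  have vV: "v ` I \<subseteq> V"
    using lz by (auto simp: v_def V_def I_def intro!: nth_mem le_less_trans[OF st_le])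
  have "v ` I \<noteq> {}" using LI by auto
  note t = touching_main[OF VU vV this]
  let ?n = "real (card I)" and ?c = "\<lambda>i. real (card (clash u (p i) (q i)))"
  have "(\<Sum>i\<in>I. real (outdeg V (v i))) \<le> (\<Sum>i\<in>I. (real L + 3 - ?n - excess) + ?c i)"
  proof (rule sum_mono)
    fix i assume i: "i \<in> I"
    note b = block[OF i]
    have "outdeg (insert u (set (p i @ q i))) (hd (p i)) + card (pnbrs u (p i @ q i)) + excess \<le> L + 3 + card (clash u (p i) (q i))"
      by (rule outdeg_block_start[OF b(1) u(1) b(2,3,4)]) (unfold b(5), rule b(6), rule b(7), rule b(12))
    then show "real (outdeg V (v i)) \<le> (real L + 3 - ?n - excess) + ?c i"
      using cardI unfolding V_def b(5,8,9) by simp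
  qed
  also have "\<dots> = ?n * (real L + 3 - ?n - excess) + (\<Sum>i\<in>I. ?c i)" by (simp add: sum.distrib)
  also have "(\<Sum>i\<in>I. ?c i) \<le> ?n" using sum_clash by (simp flip: of_nat_sum)
  finally have "(\<Sum>w\<in>v ` I. real (outdeg V w)) \<le> ?n * (real L + 3 - ?n - excess) + ?n"
    by (simp add: sum.reindex[OF inj_v])
  moreover have "card (v ` I) = card I" by (rule card_image[OF inj_v])
  ultimately have "(9 * real L / 7 + 2) * ?n \<le> ?n * (real L + 3 - ?n - excess) + ?n + ?n * L - ?n * (?n - 1) / 2"
    using t by simp
  then have "?n * (9 * real L / 7 + 2) \<le> ?n * (real L + 3 - ?n - excess + 1 + L - (?n - 1) / 2)"
    unfolding ring_distribs right_diff_distrib times_divide_eq_right by (simp add: algebra_simps)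
  moreover have "0 < ?n" using xI by (simp add: excess_def)
  ultimately have "9 * real L / 7 + 2 \<le> real L + 3 - ?n - excess + 1 + L - (?n - 1) / 2"
    by (simp only: mult_le_cancel_left_pos)
  \<comment> \<open>As \<open>?n\<close> is at least \<open>excess\<close>, the right-hand side is
    at most \<open>9 * L / 7 - 1 / 2\<close>. Here the coefficient \<open>9 / 7\<close> is met
    exactly.\<close>
  then show False using xI unfolding excess_def by (simp add: field_simps)
qed

text \<open>The last vertex of \<open>ys\<close> is pendant, and the others form the rainbow cycle
  closed by the edge to position \<open>L - 1\<close>.\<close>

lemma no_lpath: "\<not> lpath xs"
proof
  assume "lpath xs"
  then obtain ys where ys: "lpath ys" "L - 1 \<in> newidx {} ys" using exists_pendant_cycle by blast
  have L: "28 / 3 \<le> real L" by (rule L_large[OF ys(1)])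
  obtain zs u where zu: "ys = zs @ [u]" using lpath_nonempty[OF ys(1)] by (metis rev_exhaust)
  have len: "length zs = L" and ne: "zs \<noteq> []" using ys(1) L zu by (auto simp: lpath_def)
  have r: "rpath zs" "u \<notin> set zs" "adj (last zs) u" "ecol (last zs) u \<notin> set (ecols zs)" "u \<in> U"
    using ys(1) ne zu by (auto simp: lpath_def rpath_snoc dest: adj_verts)
  have nth: "ys ! (L - 1) = last zs" "hd ys = hd zs" 
    using len ne by (auto simp: zu nth_append last_conv_nth simp flip: len)
  have cl: "adj (hd zs) (last zs)" "ecol (hd zs) (last zs) \<notin> set (ecols ys)"
    using ys(2) nth by (auto simp: newidx_def)
  have e: "set (ecols ys) = insert (ecol (last zs) u) (set (ecols zs))" using ne by (auto simp: zu ecols_append)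
  have cl': "ecol (last zs) (hd zs) \<notin> set (ecols ys)" using cl(2) ecol_commute by metis
  have rc: "rcycle zs" unfolding rcycle_def
  proof (intro conjI)
    show "adj (last zs) (hd zs)" using cl(1) adj_commute by metis
    show "ecol (last zs) (hd zs) \<notin> set (ecols zs)" using cl' unfolding e by blast
  qed (rule r(1), rule len)
  have "ecol (last zs) u \<notin> ccols zs" using r(4) cl' unfolding e ccols_def by force
  then have "last zs \<in> pnbrs u zs" unfolding pnbrs_def using r(3) by (simp only: mem_Collect_eq insert_commute simp_thms)
  with rc show False using no_pendant_cycle r(2,5) by blast
qed

end

section \<open>The rainbow Turan number of a path\<close>

lemma (in colored_graph) rpath_rainbow_copy:
  assumes xs: "rpath xs" and len: "length xs = Suc m" and G: "U \<subseteq> verts G" "E \<subseteq> edges G"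
  shows "has_rainbow_copy (path_graph m) G col"
proof -
  let ?im = "(\<lambda>e. (!) xs ` e) ` edges (path_graph m)"
  have im: "?im = (\<lambda>i. {xs ! i, xs ! Suc i}) ` {..<m}"
  proof -
    have "edges (path_graph m) = (\<lambda>i. {i, Suc i}) ` {..<m}" by (auto simp: path_graph_def)
    then show ?thesis by (simp add: image_image)
  qed
  have "inj_on ((!) xs) {0..m}"
    using xs len by (auto simp: rpath_def inj_on_def nth_eq_iff_index_eq)
  moreover have "(!) xs ` {0..m} \<subseteq> verts G"
    using xs len G(1) by (force simp: rpath_def)
  moreover have "?im \<subseteq> edges G"
    using xs len G(2) unfolding im by (auto simp: rpath_def successively_conv_nth)
  moreover have "rainbow col ?im"
    unfolding rainbow_def im
  proof (rule inj_onI, clarify)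
    fix i j assume "i < m" "j < m" "ecol (xs ! i) (xs ! Suc i) = ecol (xs ! j) (xs ! Suc j)"
    then have "i = j" using nth_ecol_inj[OF xs, of i j] len by simp
    then show "{xs ! i, xs ! Suc i} = {xs ! j, xs ! Suc j}" by simp
  qed
  ultimately show ?thesis unfolding has_rainbow_copy_def
    by (intro exI[of _ "(!) xs"] conjI) (simp_all add: path_graph_def)
qed

text \<open>In a smallest vertex set \<open>U\<close> spanning at least \<open>c\<close> edges per
  vertex, \<open>U - S\<close> spans fewer for every proper nonempty subset \<open>S\<close>, so
  \<open>S\<close> touches at least \<open>c * card S\<close> edges. As \<open>L \<le> k\<close>,
  the same holds with \<open>L\<close> in place of \<open>k\<close>.\<close>

lemma edges_lt_if_no_rainbow_path:
  fixes G :: "'a graph" and col :: "'a set \<Rightarrow> 'c"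
  assumes G: "simple_graph G" "verts G \<noteq> {}" and col: "proper_edge_coloring G col"
    and free: "\<not> has_rainbow_copy (path_graph (k + 1)) G col"
  shows "real (card (edges G)) < (9 * real k / 7 + 2) * real (card (verts G))"
proof (rule ccontr)
  define V where "V = verts G"
  define E where "E = edges G"
  define c where "c = 9 * real k / 7 + 2"
  define P where "P A \<longleftrightarrow> A \<noteq> {} \<and> A \<subseteq> V \<and> c * card A \<le> card {e \<in> E. e \<subseteq> A}" for A
  have ed: "e \<subseteq> V \<and> card e = 2" if "e \<in> E" for e
    using G that by (auto simp: simple_graph_def V_def E_def)
  have finV: "finite V" using G by (simp add: simple_graph_def V_def)
  have finE: "finite E" by (rule finite_subset[of _ "Pow V"]) (use ed finV in auto)
  assume "\<not> ?thesis"
  moreover have "{e \<in> E. e \<subseteq> V} = E" using ed by auto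
  ultimately have "P V" using G(2) by (simp add: P_def c_def V_def E_def)
  then obtain U where U: "P U" and min: "\<And>A. P A \<Longrightarrow> card U \<le> card A"
    using ex_has_least_nat[of P V card] by blast
  define E' where "E' = {e \<in> E. e \<subseteq> U}"
  have finU: "finite U" using U finV by (auto simp: P_def intro: finite_subset)
  interpret colored_graph U E' col
    by unfold_locales (use finU ed col in \<open>auto simp: E'_def E_def proper_edge_coloring_def\<close>)
  have len: "length xs \<le> k + 1" if xs: "rpath xs" for xs
  proof (rule ccontr)
    assume l: "\<not> length xs \<le> k + 1"
    have "take (k + 2) xs \<noteq> []" using l by auto
    then have "rpath (take (k + 2) xs)"
    proof (cases "drop (k + 2) xs = []")
      case False
      then show ?thesis
        using xs rpath_append[OF \<open>take (k + 2) xs \<noteq> []\<close> False] unfolding append_take_drop_id by blast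
    qed (use xs in auto)
    then have "has_rainbow_copy (path_graph (k + 1)) G col"
      by (rule rpath_rainbow_copy) (use l U in \<open>auto simp: P_def V_def E'_def E_def\<close>)
    then show False using free by simp
  qed
  obtain v where v: "v \<in> U" using U by (auto simp: P_def)
  have "\<exists>xs. rpath xs \<and> (\<forall>ys. rpath ys \<longrightarrow> length ys \<le> length xs)"
    by (rule ex_has_greatest_nat[of rpath "[v]" length "k + 2"]) (use v len in \<open>auto simp: less_Suc_eq_le\<close>)
  then obtain xs where xs: "rpath xs" and mx: "\<And>ys. rpath ys \<Longrightarrow> length ys \<le> length xs" by blast
  define L where "L = length xs - 1"
  have lx: "length xs = Suc L" using xs by (cases xs) (auto simp: L_def rpath_def)
  have Lk: "L \<le> k" using len[OF xs] lx by simp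
  have touch: "c * card S \<le> card {e \<in> E'. e \<inter> S \<noteq> {}}" if S: "S \<subseteq> U" "S \<noteq> {}" for S
  proof (cases "S = U")
    case True
    have "{e \<in> E'. e \<inter> U \<noteq> {}} = E'"
      using edge_verts by (auto simp: Int_absorb2) (metis card.empty zero_neq_numeral)
    then show ?thesis using U True by (simp add: P_def E'_def)
  next
    case False
    have fS: "finite S" using S finU finite_subset by blast
    have cd: "card (U - S) + card S = card U" using S finU fS by (simp add: card_Diff_subset card_mono)
    have "card S \<noteq> 0" using S fS by simp
    then have "\<not> P (U - S)" using min[of "U - S"] cd by linarith
    then have 1: "card {e \<in> E. e \<subseteq> U - S} < c * card (U - S)" using False S U by (auto simp: P_def)
    have "E' = {e \<in> E'. e \<inter> S \<noteq> {}} \<union> {e \<in> E. e \<subseteq> U - S}" by (auto simp: E'_def)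
    then have "card E' = card ({e \<in> E'. e \<inter> S \<noteq> {}} \<union> {e \<in> E. e \<subseteq> U - S})" by (rule arg_cong)
    also have "\<dots> \<le> card {e \<in> E'. e \<inter> S \<noteq> {}} + card {e \<in> E. e \<subseteq> U - S}" by (rule card_Un_le)
    finally have "card E' \<le> card {e \<in> E'. e \<inter> S \<noteq> {}} + card {e \<in> E. e \<subseteq> U - S}" .
    moreover have "c * card U \<le> card E'" using U by (simp add: P_def E'_def)
    moreover have "c * card U = c * card (U - S) + c * card S" unfolding cd[symmetric] by (simp add: distrib_left)
    ultimately show ?thesis using 1 by linarith
  qed
  interpret longest_rainbow U E' col L
  proof
    show "length ys \<le> Suc L" if "rpath ys" for ys using mx[OF that] lx by simp
    show "(9 * real L / 7 + 2) * card S \<le> card {e \<in> E'. e \<inter> S \<noteq> {}}" if "S \<subseteq> U" "S \<noteq> {}" for S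
    proof -
      have "(9 * real L / 7 + 2) * card S \<le> c * card S"
        using Lk by (intro mult_right_mono) (auto simp: c_def)
      then show ?thesis using touch[OF that] by linarith
    qed
  qed
  show False using no_lpath[of xs] xs lx by (simp add: lpath_def)
qed

theorem theorem2:
  fixes k n :: nat
  assumes "k \<ge> 1" and "n \<ge> 1"
  shows "real (rainbow_turan n (path_graph (k + 1))) < (9 * real k / 7 + 2) * real n"
proof -
  have "edges (path_graph (k + 1)) \<noteq> {}" by (auto simp: path_graph_def)
  then have "rainbow_turan n (path_graph (k + 1)) \<in> rainbow_free_sizes n (path_graph (k + 1))"
    unfolding rainbow_turan_def
    by (intro Max_in finite_rainbow_free_sizes rainbow_free_sizes_nonempty)
  then obtain G :: "nat graph" and col :: "nat set \<Rightarrow> nat" 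
    where G: "rainbow_turan n (path_graph (k + 1)) = card (edges G)" "simple_graph G" "verts G = {..<n}"
      "proper_edge_coloring G col" "\<not> has_rainbow_copy (path_graph (k + 1)) G col"
    unfolding rainbow_free_sizes_def by blast
  have "verts G \<noteq> {}" using assms(2) by (auto simp: G(3) lessThan_empty_iff)
  from edges_lt_if_no_rainbow_path[OF G(2) this G(4,5)] show ?thesis unfolding G(1,3) by simp
qed

end
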